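(* For all integers $N\ge1$, $$\frac{H_{2N}}{c}\ \le\ \mathrm{wt}(N)\ \le\ 45000\,\bigl(1+(\log N)^3\bigr),\qquad c=\frac{60}{6/\pi^2-1/2}=555.930\ldots,$$ where $H_{2N}=\sum_{n=1}^{2N}\frac1n$. In particular $\mathrm{wt}(N)$ grows at least like a constant times $\log N$ and at most like a constant times $(\log N)^3$.
   Context: Let $B(x)=\min_{k\in\mathbb Z}\frac12(x-\frac12+k)^2$. For $N\ge1$ define $\max(N)=\sup\bigl\{\min_{x\in\mathbb R}\sum_{j=1}^NB(a_jx):\ a_1,\dots,a_N\in\mathbb Z_{\ge1}\bigr\}$ and $\mathrm{wt}(N)=\frac N2-12\max(N)$ (the lowest weight of a Jacobi form which is a theta block $\vartheta(\tau,a_1z)\cdots\vartheta(\tau,a_Nz)$ divided by a fractional power of the Dedekind eta function). $\log$ is the natural logarithm. *)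

theory Defs
  imports "HOL-Analysis.Analysis" "HOL-Library.Landau_Symbols"
begin

text \<open>The minima in the definitions below are written as infima; the lemmas
  \<open>theta_B_min\<close>, \<open>theta_block_min_attained\<close> and \<open>theta_max_set\<close> show that they are attained
  and that the supremum is taken over a nonempty set that is bounded above.\<close>

definition theta_B :: "real \<Rightarrow> real" where
  "theta_B x = (INF k::int. 1/2 * (x - 1/2 + of_int k)\<^sup>2)"

definition theta_block_min :: "nat \<Rightarrow> (nat \<Rightarrow> nat) \<Rightarrow> real" where
  "theta_block_min N a = (INF x::real. \<Sum>j=1..N. theta_B (real (a j) * x))"

definition theta_max :: "nat \<Rightarrow> real" where
  "theta_max N = Sup {theta_block_min N a | a. \<forall>j\<in>{1..N}. a j \<ge> 1}"

definition theta_wt :: "nat \<Rightarrow> real" where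
  "theta_wt N = real N / 2 - 12 * theta_max N"

lemma theta_B_le: "theta_B x \<le> 1/2 * (x - 1/2 + of_int k)\<^sup>2"
  unfolding theta_B_def by (rule cINF_lower) (auto intro!: bdd_belowI[of _ 0])

lemma theta_B_eq_frac: "theta_B x = 1/2 * (frac x - 1/2)\<^sup>2"
proof (rule antisym)
  show "theta_B x \<le> 1/2 * (frac x - 1/2)\<^sup>2"
    using theta_B_le[of x "- \<lfloor>x\<rfloor>"] by (simp add: frac_def algebra_simps)
  have "(frac x - 1/2)\<^sup>2 \<le> (x - 1/2 + of_int k)\<^sup>2" for k :: int
  proof -
    define t where "t = frac x - 1/2"
    define m where "m = k + \<lfloor>x\<rfloor>"
    have t: "-1/2 \<le> t" "t \<le> 1/2"
      using frac_ge_0[of x] frac_lt_1[of x] by (auto simp: t_def)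
    have "0 \<le> real_of_int m * (2 * t + of_int m)"
    proof (cases m "0::int" rule: linorder_cases)
      case less
      hence "real_of_int m \<le> -1" by linarith
      thus ?thesis using t by (intro mult_nonpos_nonpos) auto
    next
      case greater
      hence "real_of_int m \<ge> 1" by linarith
      thus ?thesis using t by (intro mult_nonneg_nonneg) auto
    qed simp
    moreover have "x - 1/2 + of_int k = t + of_int m"
      by (simp add: t_def m_def frac_def)
    ultimately show ?thesis
      by (simp add: t_def[symmetric] power2_eq_square algebra_simps)
  qed
  thus "1/2 * (frac x - 1/2)\<^sup>2 \<le> theta_B x"
    unfolding theta_B_def by (intro cINF_greatest) auto
qed

lemma theta_B_min:
  "\<exists>k::int. theta_B x = 1/2 * (x - 1/2 + of_int k)\<^sup>2 \<and>
     (\<forall>l::int. theta_B x \<le> 1/2 * (x - 1/2 + of_int l)\<^sup>2)"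
proof (intro exI conjI allI)
  show "theta_B x = 1/2 * (x - 1/2 + of_int (- \<lfloor>x\<rfloor>))\<^sup>2"
    by (simp add: theta_B_eq_frac frac_def algebra_simps)
qed (rule theta_B_le)

lemma theta_B_nonneg: "0 \<le> theta_B x"
  by (simp add: theta_B_eq_frac)

lemma theta_B_add_int: "theta_B (x + of_int m) = theta_B x"
  by (simp add: theta_B_eq_frac frac_def)

lemma continuous_theta_B: "continuous_on UNIV theta_B"
proof -
  have step: "theta_B x \<le> theta_B y + (\<bar>x - y\<bar> / 2 + (x - y)\<^sup>2 / 2)" for x y
  proof -
    define t where "t = frac y - 1/2"
    have t: "\<bar>t\<bar> \<le> 1/2"
      using frac_ge_0[of y] frac_lt_1[of y] unfolding t_def by linarith
    have "theta_B x \<le> 1/2 * (x - 1/2 + of_int (- \<lfloor>y\<rfloor>))\<^sup>2" by (rule theta_B_le)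
    also have "x - 1/2 + of_int (- \<lfloor>y\<rfloor>) = t + (x - y)" by (simp add: t_def frac_def)
    also have "1/2 * (t + (x - y))\<^sup>2 = theta_B y + (t * (x - y) + (x - y)\<^sup>2 / 2)"
      by (simp add: theta_B_eq_frac t_def[symmetric] power2_eq_square field_simps)
    also have "t * (x - y) \<le> \<bar>t\<bar> * \<bar>x - y\<bar>" by (metis abs_ge_self abs_mult)
    also have "\<bar>t\<bar> * \<bar>x - y\<bar> \<le> \<bar>x - y\<bar> / 2"
      using mult_right_mono[OF t, of "\<bar>x - y\<bar>"] by simp
    finally show ?thesis by simp
  qed
  have "isCont theta_B y" for y
  proof -
    have "((\<lambda>x. \<bar>x - y\<bar> / 2 + (x - y)\<^sup>2 / 2) \<longlongrightarrow> \<bar>y - y\<bar> / 2 + (y - y)\<^sup>2 / 2) (at y)"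
      by (intro tendsto_intros) auto
    hence lim: "((\<lambda>x. \<bar>x - y\<bar> / 2 + (x - y)\<^sup>2 / 2) \<longlongrightarrow> 0) (at y)" by simp
    have "norm (theta_B x - theta_B y) \<le> \<bar>x - y\<bar> / 2 + (x - y)\<^sup>2 / 2" for x
      using step[of x y] step[of y x]
      by (simp add: abs_le_iff abs_minus_commute power2_commute)
    hence "((\<lambda>x. theta_B x - theta_B y) \<longlongrightarrow> 0) (at y)"
      by (intro Lim_null_comparison[OF _ lim]) auto
    thus ?thesis unfolding isCont_def by (simp add: LIM_zero_iff)
  qed
  thus ?thesis by (simp add: continuous_on_eq_continuous_at)
qed

lemma theta_block_min_attained:
  "\<exists>x. theta_block_min N a = (\<Sum>j=1..N. theta_B (real (a j) * x)) \<and>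
     (\<forall>y. theta_block_min N a \<le> (\<Sum>j=1..N. theta_B (real (a j) * y)))"
proof -
  define f where "f x = (\<Sum>j=1..N. theta_B (real (a j) * x))" for x
  have "continuous_on {0..1} f"
    unfolding f_def
    by (intro continuous_intros continuous_on_compose2[OF continuous_theta_B]) auto
  then obtain x where x: "\<forall>y\<in>{0..1}. f x \<le> f y"
    using continuous_attains_inf[of "{0..1::real}" f] by auto
  have per: "f y = f (frac y)" for y
  proof -
    have "theta_B (real (a j) * y) = theta_B (real (a j) * frac y)" for j
      using theta_B_add_int[of "real (a j) * frac y" "int (a j) * \<lfloor>y\<rfloor>"]
      by (simp add: frac_def algebra_simps)
    thus ?thesis by (simp add: f_def)
  qed
  have le: "f x \<le> f y" for y
    using x frac_ge_0[of y] frac_lt_1[of y] by (subst per[of y]) auto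
  have "theta_block_min N a = f x"
    unfolding theta_block_min_def f_def[symmetric]
    by (rule cInf_eq_minimum) (auto simp: le)
  thus ?thesis using le unfolding f_def by auto
qed

lemma theta_max_set:
  shows "{theta_block_min N a | a. \<forall>j\<in>{1..N}. a j \<ge> 1} \<noteq> {}"
    and "bdd_above {theta_block_min N a | a. \<forall>j\<in>{1..N}. a j \<ge> 1}"
proof -
  show "{theta_block_min N a | a. \<forall>j\<in>{1..N}. a j \<ge> 1} \<noteq> {}"
    by (auto intro: exI[of _ "\<lambda>_. 1"])
  have "theta_block_min N a \<le> (\<Sum>j=1..N. theta_B (real (a j) * 0))" for a
    using theta_block_min_attained[of N a] by blast
  thus "bdd_above {theta_block_min N a | a. \<forall>j\<in>{1..N}. a j \<ge> 1}"
    by (intro bdd_aboveI[of _ "\<Sum>j=1..N. theta_B 0"]) auto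
qed

end

(* Lower bound: V(x) = sum_j B(a_j x) - N/24 has mean 0, so its L^1 norm is at most 2 |min V|, and its
   Fourier expansion is (1/(4 pi^2)) sum_n P(n x) / n^2 with P(x) = sum_j 2 cos(2 pi a_j x).  Since the terms
   n >= 2 carry total weight pi^2/6 - 1 < 1, the L^1 norm of P is controlled by that of V.  On the other hand P
   is a sum of 2N exponentials, so Littlewood's conjecture in the form of McGehee, Pigno and Smith bounds its
   L^1 norm below by H_{2N} / 30; this gives the constant c.

   Upper bound: take the multiset union of the intervals {1..n_i}, which turns the sum of cosines into
   sum_i (sin((n_i + 1/2) x) / sin(x/2) - 1) / 2.  Choose about (log N)^2 values n_i in each dyadic block
   [2^j, 2^{j+1}).  For x of size 2^{-m} the blocks up to m contribute a positive multiple of (log N)^2, while a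
   random choice makes the deviation over all higher blocks smaller than that for every x.  The choice is made in
   pairs n, 3 * 2^j - 1 - n, so that the number of elements does not depend on it. *)

theory Submission
  imports Defs "HOL-Complex_Analysis.Complex_Analysis"
begin

section \<open>Bounds for the constant\<close>

text \<open>The exponent 3 is the outcome of a balance. With l pairs in each of about log N blocks,
  the guaranteed gain at an angle comes from one scale and has order l, while concentration over a
  grid of O(N) angles loses about sqrt(l) * log N. So l must have order (log N)^2. Each interval
  costs 1/2 through the -1 in its closed form, which adds up to about l * log N. The construction
  runs only for N > 90000 (1 + (log N)^3) and then costs less than 6000 (log N)^3; for smaller N,
  the trivial bound wt(N) <= N/2 is used, and this is what fixes 45000. A bound -K for the cosine
  sum passes to wt without loss, because the Fourier coefficients of B are positive with sum 1/12.
  In the lower bound 30 = 5 * 2 * 3: the sup norm of the test function, the half of each Fourier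
  coefficient that survives the corrections, and the factor 3 between a rank and the size of its
  block. The frequencies a_j may coincide, so the Littlewood inequality has to hold for sums of
  characters with multiplicity.\<close>

lemma arctan_taylor_sign:
  fixes x :: real
  assumes "0 \<le> x"
  shows "0 \<le> (-1) ^ n * (arctan x - (\<Sum>k<n. (-1) ^ k * x ^ (2 * k + 1) / real (2 * k + 1)))"
proof -
  define f where "f t = (-1) ^ n * (arctan t - (\<Sum>k<n. (-1) ^ k * t ^ (2 * k + 1) / real (2 * k + 1)))" for t :: real
  \<comment> \<open>Subtracting the finite geometric series from 1 / (1 + t^2) leaves a remainder
    whose sign is cancelled by the factor \<open>(-1) ^ n\<close>; hence \<open>f\<close> increases
    from \<open>f 0 = 0\<close>.\<close>
  have "(f has_real_derivative (t\<^sup>2) ^ n / (1 + t\<^sup>2)) (at t)" for t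
  proof -
    have nz: "1 + t\<^sup>2 \<noteq> 0" by (smt (verit) zero_le_power2)
    have term_deriv: "((\<lambda>t. (-1) ^ k * t ^ (2 * k + 1) / real (2 * k + 1)) has_real_derivative (- (t\<^sup>2)) ^ k) (at t)" for k
    proof -
      have "((\<lambda>t. (-1) ^ k * t ^ (2 * k + 1) / real (2 * k + 1)) has_real_derivative
              (-1) ^ k * (real (2 * k + 1) * t ^ (2 * k)) / real (2 * k + 1)) (at t)"
        by (rule derivative_eq_intros refl | simp)+
      also have "(-1) ^ k * (real (2 * k + 1) * t ^ (2 * k)) / real (2 * k + 1) = (-1) ^ k * t ^ (2 * k)"
        by (simp del: of_nat_add of_nat_mult)
      also have "\<dots> = (- (t\<^sup>2)) ^ k" by (simp add: power_mult flip: power_mult_distrib)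
      finally show ?thesis .
    qed
    have sum: "(\<Sum>k<n. (- (t\<^sup>2)) ^ k) = (1 - (- (t\<^sup>2)) ^ n) / (1 + t\<^sup>2)"
      using nz by (subst sum_gp_strict) auto
    have "(f has_real_derivative (-1) ^ n * (inverse (1 + t\<^sup>2) - (\<Sum>k<n. (- (t\<^sup>2)) ^ k))) (at t)"
      unfolding f_def by (intro DERIV_cmult DERIV_diff DERIV_arctan DERIV_sum term_deriv)
    moreover have "(-1) ^ n * (inverse (1 + t\<^sup>2) - (\<Sum>k<n. (- (t\<^sup>2)) ^ k)) = (-1) ^ n * (- (t\<^sup>2)) ^ n / (1 + t\<^sup>2)"
      unfolding sum using nz by (simp add: field_simps)
    moreover have "(-1) ^ n * (- (t\<^sup>2)) ^ n = (t\<^sup>2) ^ n"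
      by (simp flip: power_mult_distrib)
    ultimately show ?thesis by simp
  qed
  then have "f 0 \<le> f x"
    using assms by (intro DERIV_nonneg_imp_nondecreasing[OF assms]) (metis divide_nonneg_nonneg add_nonneg_nonneg zero_le_one zero_le_power zero_le_power2)
  thus ?thesis by (simp add: f_def)
qed

text \<open>Machin's formula, with both arctangents enclosed between consecutive partial sums: an
  even number of terms bounds from below, an odd number from above.\<close>

lemma pi_bounds: "3.1415923 \<le> pi" "pi \<le> 3.1415927"
  using machin arctan_taylor_sign[of "1/5" 5] arctan_taylor_sign[of "1/5" 6]
    arctan_taylor_sign[of "1/239" 1] arctan_taylor_sign[of "1/239" 2]
  by (simp_all add: power_divide eval_nat_numeral)

lemma littlewood_constant_bounds:
  defines "c \<equiv> 60 / (6 / pi\<^sup>2 - 1/2)"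
  shows "555.930 \<le> c" "c < 555.931"
proof -
  have p1: "(3.1415923::real)\<^sup>2 \<le> pi\<^sup>2" and p2: "pi\<^sup>2 \<le> (3.1415927::real)\<^sup>2"
    using pi_bounds by (auto intro!: power_mono)
  have pos: "0 < 6 / pi\<^sup>2 - 1/2" using p2 by (simp add: field_simps power2_eq_square)
  show "555.930 \<le> c" using pos p1 by (simp add: c_def field_simps power2_eq_square)
  show "c < 555.931" using pos p2 by (simp add: c_def field_simps power2_eq_square)
qed

section \<open>Fourier expansion of \<open>theta_B\<close>\<close>

lemma theta_B_unit: 
  assumes "0 \<le> x" "x \<le> 1" shows "theta_B x = 1/2 * (x - 1/2)\<^sup>2"
proof (cases "x = 1")
  case True
  thus ?thesis by (simp add: theta_B_eq_frac frac_def power2_eq_square)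
next
  case False
  hence "frac x = x" using assms by (simp add: frac_eq)
  thus ?thesis by (simp add: theta_B_eq_frac)
qed

lemma cosine_sum_closed_form:
  fixes x :: real
  shows "(1 + 2 * (\<Sum>k=1..n. cos (2 * pi * real k * x))) * sin (pi * x) = sin ((2 * real n + 1) * pi * x)"
proof (induction n)
  case (Suc n)
  have "sin (2 * pi * real (Suc n) * x + pi * x) - sin (2 * pi * real (Suc n) * x - pi * x)
      = 2 * cos (2 * pi * real (Suc n) * x) * sin (pi * x)"
    by (simp add: sin_add sin_diff)
  moreover have "2 * pi * real (Suc n) * x + pi * x = (2 * real (Suc n) + 1) * pi * x"
    "2 * pi * real (Suc n) * x - pi * x = (2 * real n + 1) * pi * x"
    by (simp_all add: algebra_simps)
  ultimately have "sin ((2 * real (Suc n) + 1) * pi * x) - sin ((2 * real n + 1) * pi * x)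
      = 2 * cos (2 * pi * real (Suc n) * x) * sin (pi * x)"
    by simp
  with Suc show ?case by (simp add: algebra_simps)
qed simp

lemma inverse_squares_sums_Suc: "(\<lambda>n. 1 / (real (Suc n))\<^sup>2) sums (pi\<^sup>2 / 6)"
  using inverse_squares_sums by (simp add: add.commute)

lemma norm_cos_div_square_le: "norm (cos y / (real (Suc n))\<^sup>2) \<le> 1 / (real (Suc n))\<^sup>2"
  by (simp add: divide_right_mono)

lemma summable_cos_div_square: "summable (\<lambda>n. cos (2 * pi * real (Suc n) * x) / (real (Suc n))\<^sup>2)"
  by (rule summable_comparison_test'[OF sums_summable[OF inverse_squares_sums_Suc] norm_cos_div_square_le])

lemma uniform_limit_cos_series:
  "uniform_limit UNIV (\<lambda>n x. \<Sum>k<n. cos (2 * pi * real (Suc k) * x) / (real (Suc k))\<^sup>2)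
     (\<lambda>x. \<Sum>k. cos (2 * pi * real (Suc k) * x) / (real (Suc k))\<^sup>2) sequentially"
  by (rule Weierstrass_m_test[OF norm_cos_div_square_le sums_summable[OF inverse_squares_sums_Suc]])

lemma continuous_on_cos_series:
  "continuous_on UNIV (\<lambda>x. \<Sum>k. cos (2 * pi * real (Suc k) * x) / (real (Suc k))\<^sup>2)"
  by (rule uniform_limit_theorem[OF _ uniform_limit_cos_series])
     (auto intro!: always_eventually continuous_intros)

text \<open>The second derivative of \<open>E\<close> is the Dirichlet kernel, which oscillates at
  frequency about n away from the integers, so integrating it gains a factor 1/n. Two applications
  of the mean value inequality, both based at 1/2, make this quantitative and yield a pointwise
  Fourier expansion directly.\<close>

lemma parabola_minus_cosine_sum_bound:
  fixes x :: real and n :: nat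
  defines "E \<equiv> \<lambda>t. 1/2 * (t - 1/2)\<^sup>2 - 1 / (2 * pi\<^sup>2) * (\<Sum>k=1..n. cos (2 * pi * real k * t) / (real k)\<^sup>2)"
  assumes x: "0 < x" "x < 1"
  shows "\<bar>E x - E (1/2)\<bar> \<le> 2 / ((sin (pi * x))\<^sup>2 * (2 * real n + 1))"
proof -
  define m where "m = sin (pi * x)"
  define q where "q = 2 * real n + 1"
  define S where "S = closed_segment (1/2) x"
  define d where "d t = (t - 1/2) + 1 / pi * (\<Sum>k=1..n. sin (2 * pi * real k * t) / real k)" for t :: real
  have q: "q > 0" by (simp add: q_def)
  have m: "0 < m" "m \<le> 1" using x by (auto simp: m_def intro!: sin_gt_zero)
  have dist: "\<bar>t - 1/2\<bar> \<le> 1" if "t \<in> S" for t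
    using that x by (auto simp: S_def closed_segment_eq_real_ivl split: if_splits)
  have sin_ge: "m \<le> sin (pi * t)" if "t \<in> S" for t
  proof -
    have c: "sin (pi * u) = cos (pi * \<bar>u - 1/2\<bar>)" for u
    proof -
      have "cos (pi * \<bar>u - 1/2\<bar>) = cos \<bar>pi * (u - 1/2)\<bar>"
        by (simp add: abs_mult)
      also have "\<dots> = cos (pi * (u - 1/2))" by (rule cos_abs_real)
      also have "\<dots> = cos (pi / 2 - pi * u)"
        by (subst cos_minus[symmetric]) (simp add: algebra_simps)
      also have "\<dots> = sin (pi * u)" by (simp add: sin_cos_eq)
      finally show ?thesis by simp
    qed
    have "\<bar>t - 1/2\<bar> \<le> \<bar>x - 1/2\<bar>"
      using that x by (auto simp: S_def closed_segment_eq_real_ivl split: if_splits)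
    moreover have "\<bar>x - 1/2\<bar> \<le> 1" using x by auto
    ultimately show ?thesis
      unfolding m_def c by (intro cos_monotone_0_pi_le) auto
  qed
  have pos: "0 < sin (pi * t)" if "t \<in> S" for t
    using sin_ge[OF that] m by linarith
  have dE: "(E has_real_derivative d t) (at t)" for t
  proof -
    have "((\<lambda>t. cos (2 * pi * real k * t) / (real k)\<^sup>2) has_real_derivative
           - (2 * pi * (sin (2 * pi * real k * t) / real k))) (at t)" if "k \<in> {1..n}" for k
    proof -
      have "((\<lambda>t. cos (2 * pi * real k * t) / (real k)\<^sup>2) has_real_derivative
           - sin (2 * pi * real k * t) * (2 * pi * real k) / (real k)\<^sup>2) (at t)"
        by (rule DERIV_cdivide) (auto intro!: derivative_eq_intros)
      thus ?thesis using that by (simp add: power2_eq_square mult_ac)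
    qed
    hence "((\<lambda>t. \<Sum>k=1..n. cos (2 * pi * real k * t) / (real k)\<^sup>2) has_real_derivative
           (\<Sum>k=1..n. - (2 * pi * (sin (2 * pi * real k * t) / real k)))) (at t)"
      by (intro DERIV_sum)
    hence "(E has_real_derivative (t - 1/2) - 1 / (2 * pi\<^sup>2) *
           (\<Sum>k=1..n. - (2 * pi * (sin (2 * pi * real k * t) / real k)))) (at t)"
      unfolding E_def by (intro DERIV_diff DERIV_cmult) (auto intro!: derivative_eq_intros)
    also have "(\<Sum>k=1..n. - (2 * pi * (sin (2 * pi * real k * t) / real k)))
        = - (2 * pi) * (\<Sum>k=1..n. sin (2 * pi * real k * t) / real k)"
      by (simp add: sum_distrib_left sum_negf)
    finally show ?thesis by (simp add: d_def power2_eq_square)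
  qed
  have dd: "(d has_real_derivative sin (q * (pi * t)) / sin (pi * t)) (at t)" if "t \<in> S" for t
  proof -
    have "((\<lambda>t. sin (2 * pi * real k * t) / real k) has_real_derivative
           2 * pi * cos (2 * pi * real k * t)) (at t)" if "k \<in> {1..n}" for k
    proof -
      have "((\<lambda>t. sin (2 * pi * real k * t) / real k) has_real_derivative
           cos (2 * pi * real k * t) * (2 * pi * real k) / real k) (at t)"
        by (rule DERIV_cdivide) (auto intro!: derivative_eq_intros)
      thus ?thesis using that by (simp add: mult_ac)
    qed
    hence "((\<lambda>t. \<Sum>k=1..n. sin (2 * pi * real k * t) / real k) has_real_derivative
           (\<Sum>k=1..n. 2 * pi * cos (2 * pi * real k * t))) (at t)"
      by (intro DERIV_sum)
    hence "(d has_real_derivative 1 + 1 / pi * (\<Sum>k=1..n. 2 * pi * cos (2 * pi * real k * t))) (at t)"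
      unfolding d_def by (intro DERIV_add DERIV_cmult) (auto intro!: derivative_eq_intros)
    also have "(\<Sum>k=1..n. 2 * pi * cos (2 * pi * real k * t)) = 2 * pi * (\<Sum>k=1..n. cos (2 * pi * real k * t))"
      by (simp add: sum_distrib_left)
    also have "1 + 1 / pi * (2 * pi * (\<Sum>k=1..n. cos (2 * pi * real k * t))) = 1 + 2 * (\<Sum>k=1..n. cos (2 * pi * real k * t))"
      by simp
    also have "\<dots> = sin (q * (pi * t)) / sin (pi * t)"
      using cosine_sum_closed_form[where x = t and n = n] pos[OF that]
      by (simp add: eq_divide_eq q_def mult_ac)
    finally show ?thesis .
  qed
  \<comment> \<open>One integration by parts of the Dirichlet kernel: the added term cancels its
    leading oscillation, and what remains of the derivative is O(1/q).\<close>
  define D where "D t = d t + cos (q * (pi * t)) / (q * pi * sin (pi * t))" for t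
  have dD: "(D has_real_derivative - (cos (q * (pi * t)) * cos (pi * t) / (q * (sin (pi * t))\<^sup>2))) (at t)"
    if "t \<in> S" for t
  proof -
    have quot: "((\<lambda>t. cos (q * (pi * t)) / (q * pi * sin (pi * t))) has_real_derivative
       (- sin (q * (pi * t)) * (q * pi) * (q * pi * sin (pi * t)) - cos (q * (pi * t)) * (q * pi * (cos (pi * t) * pi))) /
       ((q * pi * sin (pi * t)) * (q * pi * sin (pi * t)))) (at t)"
      using pos[OF that] q by (intro DERIV_divide) (auto intro!: derivative_eq_intros)
    have eq: "sin (q * (pi * t)) / sin (pi * t) +
       (- sin (q * (pi * t)) * (q * pi) * (q * pi * sin (pi * t)) - cos (q * (pi * t)) * (q * pi * (cos (pi * t) * pi))) /
       ((q * pi * sin (pi * t)) * (q * pi * sin (pi * t))) = - (cos (q * (pi * t)) * cos (pi * t) / (q * (sin (pi * t))\<^sup>2))"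
      using pos[OF that] q by (simp add: field_simps power2_eq_square)
    show ?thesis
      unfolding D_def using DERIV_add[OF dd[OF that] quot] by (simp only: eq)
  qed
  \<comment> \<open>The point 1/2 is the centre of symmetry: every sine vanishes there, and q * pi /
    2 is an odd multiple of pi / 2.\<close>
  have D0: "D (1/2) = 0"
  proof -
    have "cos (q * (pi * (1/2))) = cos (real n * pi + pi / 2)"
      by (simp add: q_def algebra_simps)
    also have "\<dots> = 0" by (simp add: cos_add)
    finally have "cos (q * (pi * (1/2))) = 0" .
    moreover have "sin (2 * pi * real k * (1/2)) = 0" for k
      using sin_npi2[of k] by (simp add: mult_ac)
    ultimately show ?thesis unfolding D_def d_def by simp
  qed
  have D: "\<bar>D t\<bar> \<le> 1 / (m\<^sup>2 * q)" if "t \<in> S" for t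
  proof -
    have "norm (D t - D (1/2)) \<le> 1 / (m\<^sup>2 * q) * norm (t - 1/2)"
    proof (rule field_differentiable_bound[where S = S])
      show "convex S" "t \<in> S" "1/2 \<in> S" using that by (auto simp: S_def)
      show "(D has_real_derivative - (cos (q * (pi * t)) * cos (pi * t) / (q * (sin (pi * t))\<^sup>2))) (at t within S)"
        if "t \<in> S" for t using dD[OF that] by (rule DERIV_subset) auto
      show "norm (- (cos (q * (pi * t)) * cos (pi * t) / (q * (sin (pi * t))\<^sup>2))) \<le> 1 / (m\<^sup>2 * q)"
        if "t \<in> S" for t
      proof -
        have "\<bar>cos (q * (pi * t)) * cos (pi * t)\<bar> \<le> 1 * 1"
          unfolding abs_mult by (intro mult_mono) auto
        moreover have "m\<^sup>2 * q \<le> q * (sin (pi * t))\<^sup>2"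
          using sin_ge[OF that] m q by (simp add: power_mono)
        ultimately show ?thesis using m q pos[OF that] by (auto simp: abs_mult intro!: frac_le)
      qed
    qed
    also have "\<dots> \<le> 1 / (m\<^sup>2 * q) * 1"
      using dist[OF that] m q by (intro mult_left_mono) auto
    finally show ?thesis by (simp add: D0)
  qed
  have d_le: "\<bar>d t\<bar> \<le> 2 / (m\<^sup>2 * q)" if "t \<in> S" for t
  proof -
    have "\<bar>cos (q * (pi * t)) / (q * pi * sin (pi * t))\<bar> \<le> 1 / (m\<^sup>2 * q)"
    proof -
      have "m\<^sup>2 \<le> pi * sin (pi * t)"
      proof -
        have "m\<^sup>2 \<le> 1 * sin (pi * t)"
          using sin_ge[OF that] m by (simp add: power2_eq_square) (smt (verit) mult_left_le)
        also have "\<dots> \<le> pi * sin (pi * t)"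
          using pi_ge_two pos[OF that] by (intro mult_right_mono) auto
        finally show ?thesis .
      qed
      hence "m\<^sup>2 * q \<le> q * pi * sin (pi * t)" using q by (simp add: mult_ac)
      thus ?thesis using m q pos[OF that] by (auto simp: abs_mult intro!: frac_le)
    qed
    note w = this
    have "d t = D t - cos (q * (pi * t)) / (q * pi * sin (pi * t))" by (simp add: D_def)
    hence "\<bar>d t\<bar> \<le> \<bar>D t\<bar> + \<bar>cos (q * (pi * t)) / (q * pi * sin (pi * t))\<bar>"
      by (simp only: abs_triangle_ineq4)
    also have "\<dots> \<le> 1 / (m\<^sup>2 * q) + 1 / (m\<^sup>2 * q)"
      using D[OF that] w by (rule add_mono)
    finally show ?thesis by (simp add: mult.commute)
  qed
  have "norm (E x - E (1/2)) \<le> 2 / (m\<^sup>2 * q) * norm (x - 1/2)"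
  proof (rule field_differentiable_bound[where S = S and f' = d])
    show "convex S" "x \<in> S" "1/2 \<in> S" by (auto simp: S_def)
    show "(E has_real_derivative d t) (at t within S)" for t
      using dE by (rule DERIV_subset) auto
    show "norm (d t) \<le> 2 / (m\<^sup>2 * q)" if "t \<in> S" for t
      using d_le[OF that] by simp
  qed
  also have "\<dots> \<le> 2 / (m\<^sup>2 * q) * 1"
    using dist[of x] m q by (intro mult_left_mono) (auto simp: S_def)
  finally show ?thesis by (simp add: m_def q_def)
qed

text \<open>Parabola minus series is constant on the open interval by the O(1/n) estimate and on the
  closed one by continuity. At 0 the series is pi^2 / 6, so the constant is 1/8 - 1/12 =
  1/24.\<close>

lemma theta_B_cos_series_unit:
  assumes "0 \<le> x" "x \<le> 1"
  shows "theta_B x = 1/24 + 1 / (2 * pi\<^sup>2) * (\<Sum>k. cos (2 * pi * real (Suc k) * x) / (real (Suc k))\<^sup>2)"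
proof -
  define s where "s t = (\<Sum>k. cos (2 * pi * real (Suc k) * t) / (real (Suc k))\<^sup>2)" for t
  define G where "G t = 1/2 * (t - 1/2)\<^sup>2 - 1 / (2 * pi\<^sup>2) * s t" for t
  define E where "E n t = 1/2 * (t - 1/2)\<^sup>2 - 1 / (2 * pi\<^sup>2) * (\<Sum>k=1..n. cos (2 * pi * real k * t) / (real k)\<^sup>2)" for n t
  have E_lim: "(\<lambda>n. E n t) \<longlonglongrightarrow> G t" for t
  proof -
    have "(\<lambda>n. \<Sum>k<n. cos (2 * pi * real (Suc k) * t) / (real (Suc k))\<^sup>2) \<longlonglongrightarrow> s t"
      unfolding s_def by (rule summable_LIMSEQ[OF summable_cos_div_square])
    moreover have "(\<Sum>k<n. cos (2 * pi * real (Suc k) * t) / (real (Suc k))\<^sup>2)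
        = (\<Sum>k=1..n. cos (2 * pi * real k * t) / (real k)\<^sup>2)" for n
      by (rule sum.reindex_bij_witness[of _ "\<lambda>k. k - 1" Suc]) auto
    ultimately show ?thesis
      unfolding E_def G_def by (intro tendsto_intros) simp
  qed
  have const: "G t = G (1/2)" if t: "0 < t" "t < 1" for t
  proof -
    have m: "(sin (pi * t))\<^sup>2 > 0" using t sin_gt_zero[of "pi * t"] by simp
    have lim0: "(\<lambda>n. 2 / ((sin (pi * t))\<^sup>2 * (2 * real n + 1))) \<longlonglongrightarrow> 0"
    proof -
      have "filterlim (\<lambda>n. 2 * real n + 1) at_top sequentially"
        by (rule filterlim_at_top_mono[OF filterlim_real_sequentially]) auto
      hence "(\<lambda>n. 2 / (sin (pi * t))\<^sup>2 * inverse (2 * real n + 1)) \<longlonglongrightarrow> 2 / (sin (pi * t))\<^sup>2 * 0"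
        by (intro tendsto_mult tendsto_const tendsto_inverse_0_at_top)
      thus ?thesis by (simp add: divide_inverse mult_ac)
    qed
    have bound: "norm (E n t - E n (1/2)) \<le> 2 / ((sin (pi * t))\<^sup>2 * (2 * real n + 1))" for n
      using parabola_minus_cosine_sum_bound[OF t, of n] by (simp add: E_def)
    have "(\<lambda>n. E n t - E n (1/2)) \<longlonglongrightarrow> 0"
      by (rule Lim_null_comparison[OF always_eventually[OF allI[OF bound]] lim0])
    moreover have "(\<lambda>n. E n t - E n (1/2)) \<longlonglongrightarrow> G t - G (1/2)"
      by (intro tendsto_diff E_lim)
    ultimately have "0 = G t - G (1/2)" by (rule LIMSEQ_unique)
    thus ?thesis by simp
  qed
  have cont: "continuous_on {0..1} G"
    unfolding G_def s_def
    by (intro continuous_intros continuous_on_subset[OF continuous_on_cos_series]) auto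
  have const': "G t = G (1/2)" if "t \<in> {0..1}" for t
  proof (rule continuous_constant_on_closure[of "{0<..<1}" G])
    show "continuous_on (closure {0<..<1}) G" "t \<in> closure {0<..<1}"
      using cont that by (simp_all add: closure_greaterThanLessThan)
  qed (rule const, simp_all)
  have "s 0 = pi\<^sup>2 / 6"
    unfolding s_def using sums_unique[OF inverse_squares_sums_Suc] by simp
  hence "G 0 = 1/24" by (simp add: G_def power2_eq_square field_simps)
  moreover have "G x = G 0" using const'[of 0] const'[of x] assms by simp
  ultimately have "G x = 1/24" by simp
  thus ?thesis using theta_B_unit[OF assms] by (simp add: G_def s_def)
qed

theorem theta_B_cos_series:
  "theta_B x = 1/24 + 1 / (2 * pi\<^sup>2) * (\<Sum>k. cos (2 * pi * real (Suc k) * x) / (real (Suc k))\<^sup>2)"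
proof -
  have "cos (2 * pi * real (Suc k) * frac x) = cos (2 * pi * real (Suc k) * x)" for k
  proof -
    have "2 * pi * real (Suc k) * x = 2 * pi * real (Suc k) * frac x + 2 * pi * of_int (int (Suc k) * \<lfloor>x\<rfloor>)"
      by (simp add: frac_def algebra_simps)
    thus ?thesis by (simp only: cos_add sin_int_2pin cos_int_2pin mult_zero_right mult_1_right diff_zero)
  qed
  moreover have "theta_B x = theta_B (frac x)"
    by (simp add: theta_B_eq_frac frac_def)
  ultimately show ?thesis
    using theta_B_cos_series_unit[of "frac x"] frac_ge_0[of x] frac_lt_1[of x] by simp
qed

corollary theta_B_sums:
  "(\<lambda>k. 1 / (2 * pi\<^sup>2) * (cos (2 * pi * real (Suc k) * x) / (real (Suc k))\<^sup>2)) sums (theta_B x - 1/24)"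
  using sums_mult[OF summable_sums[OF summable_cos_div_square], of "1 / (2 * pi\<^sup>2)" x]
  by (simp only: theta_B_cos_series[of x] add_diff_cancel_left')

corollary theta_B_uniform_limit:
  "uniform_limit UNIV (\<lambda>n x. 1 / (2 * pi\<^sup>2) * (\<Sum>k<n. cos (2 * pi * real (Suc k) * x) / (real (Suc k))\<^sup>2))
     (\<lambda>x. theta_B x - 1/24) sequentially"
  unfolding theta_B_cos_series add_diff_cancel_left'
  by (rule bounded_linear.uniform_limit[OF bounded_linear_mult_right uniform_limit_cos_series])

section \<open>Dilates and the transfer of L^1 norms\<close>

lemma has_integral_periodic_dilate:
  fixes g :: "real \<Rightarrow> real"
  assumes g: "(g has_integral I) {0..1}" and per: "\<And>x. g (x + 1) = g x" and n: "0 < n"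
  shows "((\<lambda>x. g (real n * x)) has_integral I) {0..1}"
proof -
  have per_n: "g (x + real k) = g x" for x k
    by (induction k) (use per[of "x + real _"] in \<open>auto simp: add_ac\<close>)
  have "(g has_integral real k * I) {0..real k}" for k
  proof (induction k)
    case (Suc k)
    have "((\<lambda>x. g (x + - real k)) has_integral I) {0 - - real k..1 - - real k}"
      by (rule has_integral_shift_real_ivl[OF g])
    moreover have "g (x + - real k) = g x" for x
      using per_n[of "x + - real k" k] by simp
    ultimately have "(g has_integral I) {real k..real (Suc k)}" by simp
    from has_integral_combine[OF _ _ Suc this] show ?case by (simp add: algebra_simps)
  qed (simp add: has_integral_refl)
  from has_integral_stretch_real[OF this[of n], where m = "real n"]
  have "((\<lambda>x. g (real n * x)) has_integral I) ((\<lambda>x. x / real n) ` {0..real n})"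
    using n by simp
  moreover have "(\<lambda>x. x / real n) ` {0..real n} = {0..1}"
    using n by (simp add: image_divide_atLeastAtMost)
  ultimately show ?thesis by simp
qed

text \<open>All dilates of \<open>P\<close> have the same L^1 norm T, so isolating the term n = 1
  gives T <= 4 pi^2 |V|_1 + (pi^2 / 6 - 1) T. Assuming only uniform approximation by finite sums
  means that sums and integrals are interchanged for finitely many continuous functions at a time;
  the price is an arbitrary e.\<close>

lemma integral_abs_le_of_dilates:
  fixes P V :: "real \<Rightarrow> real"
  assumes P: "continuous_on UNIV P" and P_per: "\<And>x. P (x + 1) = P x" and P_int: "(P has_integral 0) {0..1}"
    and V: "continuous_on UNIV V" and \<mu>: "\<And>x. \<mu> \<le> V x"
    and approx: "\<And>e. 0 < e \<Longrightarrow>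
      \<exists>M\<ge>1. \<forall>x. \<bar>V x - 1 / (4 * pi\<^sup>2) * (\<Sum>k<M. P (real (Suc k) * x) / (real (Suc k))\<^sup>2)\<bar> \<le> e"
  shows "integral {0..1} (\<lambda>x. \<bar>P x\<bar>) * (2 - pi\<^sup>2 / 6) / (4 * pi\<^sup>2) \<le> - 2 * \<mu>"
proof -
  define T where "T = integral {0..1} (\<lambda>x. \<bar>P x\<bar>)"
  have cont_P: "continuous_on A (\<lambda>x. P (c * x))" for A c
    by (intro continuous_on_compose2[OF P] continuous_intros) auto
  have cont_V: "continuous_on A V" for A
    by (rule continuous_on_subset[OF V]) simp
  have P_dil: "integral {0..1} (\<lambda>x. P (real (Suc k) * x)) = 0" for k
    by (rule integral_unique[OF has_integral_periodic_dilate[OF P_int P_per zero_less_Suc]])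
  have T_dil: "integral {0..1} (\<lambda>x. \<bar>P (real (Suc k) * x)\<bar>) = T" for k
  proof (rule integral_unique[OF has_integral_periodic_dilate[where g = "\<lambda>x. \<bar>P x\<bar>"]])
    show "((\<lambda>x. \<bar>P x\<bar>) has_integral T) {0..1}"
      unfolding T_def using cont_P[of "{0..1}" 1]
      by (intro integrable_integral integrable_continuous_interval continuous_intros) simp
  qed (auto simp: P_per)
  have T_nonneg: "0 \<le> T"
    unfolding T_def using cont_P[of "{0..1}" 1]
    by (intro integral_nonneg integrable_continuous_interval continuous_intros) auto
  have "T * (2 - pi\<^sup>2 / 6) / (4 * pi\<^sup>2) \<le> - 2 * \<mu> + e" if "e > 0" for e
  proof -
    \<comment> \<open>With e/4 the losses add up exactly: 4 pi^2 * (3/4) e from the L^1 norm of V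
      and pi^2 e from the pointwise estimate, together 4 pi^2 e.\<close>
    have e4: "0 < e / 4" using that by simp
    obtain M where M: "M \<ge> 1" "\<And>x. \<bar>V x - 1 / (4 * pi\<^sup>2) * (\<Sum>k<M. P (real (Suc k) * x) / (real (Suc k))\<^sup>2)\<bar> \<le> e / 4"
      using approx[OF e4] by blast
    define Q where "Q x = 1 / (4 * pi\<^sup>2) * (\<Sum>k<M. P (real (Suc k) * x) / (real (Suc k))\<^sup>2)" for x
    have cont_Q: "continuous_on A Q" for A
      unfolding Q_def[abs_def] by (intro continuous_intros cont_P) auto
    have "integral {0..1} (\<lambda>x. \<Sum>k<M. P (real (Suc k) * x) / (real (Suc k))\<^sup>2)
        = (\<Sum>k<M. integral {0..1} (\<lambda>x. P (real (Suc k) * x) / (real (Suc k))\<^sup>2))"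
      by (intro integral_sum integrable_continuous_interval continuous_intros cont_P) auto
    also have "\<dots> = 0"
      by (simp only: divide_inverse integral_mult_left P_dil mult_zero_left sum.neutral_const)
    finally have Q0: "integral {0..1} Q = 0"
      unfolding Q_def[abs_def] integral_mult_right by simp
    have "V x \<le> Q x + e / 4" for x
      using M(2)[of x] unfolding Q_def[symmetric] by linarith
    hence "integral {0..1} V \<le> integral {0..1} (\<lambda>x. Q x + e / 4)"
      by (intro integral_le integrable_continuous_interval continuous_intros cont_V cont_Q)
    also have "\<dots> = integral {0..1} Q + integral {0..1} (\<lambda>x::real. e / 4)"
      by (intro integral_add integrable_continuous_interval continuous_intros cont_Q)
    finally have V_le: "integral {0..1} V \<le> e / 4" using Q0 by simp
    have "integral {0..1} (\<lambda>x::real. \<mu>) \<le> integral {0..1} V"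
      using \<mu> by (intro integral_le integrable_continuous_interval continuous_intros cont_V) auto
    hence \<mu>_le: "\<mu> \<le> e / 4" using V_le by simp
    \<comment> \<open>If V x < 0 then -V x <= V x - 2 \<mu> because \<mu> <= V x. If V x >= 0 the
      added constant must be nonnegative, which is \<open>\<mu>_le\<close>; the mean of V is only
      known to be at most e/4, whence the slack e/2.\<close>
    have "integral {0..1} (\<lambda>x. \<bar>V x\<bar>) \<le> integral {0..1} (\<lambda>x. V x + (e / 2 - 2 * \<mu>))"
    proof (intro integral_le integrable_continuous_interval continuous_intros cont_V)
      show "\<bar>V x\<bar> \<le> V x + (e / 2 - 2 * \<mu>)" for x
        using \<mu>[of x] \<mu>_le that by linarith
    qed
    also have "\<dots> = integral {0..1} V + integral {0..1} (\<lambda>x::real. e / 2 - 2 * \<mu>)"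
      by (intro integral_add integrable_continuous_interval continuous_intros cont_V)
    finally have absV: "integral {0..1} (\<lambda>x. \<bar>V x\<bar>) \<le> 3 / 4 * e - 2 * \<mu>" using V_le by simp
    have pt: "\<bar>P x\<bar> \<le> 4 * pi\<^sup>2 * \<bar>V x\<bar> + ((\<Sum>k\<in>{1..<M}. \<bar>P (real (Suc k) * x)\<bar> / (real (Suc k))\<^sup>2) + pi\<^sup>2 * e)" for x
    proof -
      define R where "R = (\<Sum>k\<in>{1..<M}. P (real (Suc k) * x) / (real (Suc k))\<^sup>2)"
      have "(\<Sum>k<M. P (real (Suc k) * x) / (real (Suc k))\<^sup>2) = P x + R"
        unfolding R_def using M(1) by (simp add: lessThan_atLeast0 sum.atLeast_Suc_lessThan)
      hence "\<bar>V x - 1 / (4 * pi\<^sup>2) * (P x + R)\<bar> \<le> e / 4" using M(2)[of x] by simp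
      hence "4 * pi\<^sup>2 * \<bar>V x - 1 / (4 * pi\<^sup>2) * (P x + R)\<bar> \<le> 4 * pi\<^sup>2 * (e / 4)"
        by (intro mult_left_mono) auto
      also have "4 * pi\<^sup>2 * \<bar>V x - 1 / (4 * pi\<^sup>2) * (P x + R)\<bar> = \<bar>4 * pi\<^sup>2 * (V x - 1 / (4 * pi\<^sup>2) * (P x + R))\<bar>"
        by (simp only: abs_mult) simp
      also have "4 * pi\<^sup>2 * (V x - 1 / (4 * pi\<^sup>2) * (P x + R)) = 4 * pi\<^sup>2 * V x - (P x + R)"
        by (simp add: field_simps)
      finally have 1: "\<bar>4 * pi\<^sup>2 * V x - (P x + R)\<bar> \<le> pi\<^sup>2 * e" by simp
      have 2: "\<bar>4 * pi\<^sup>2 * V x\<bar> = 4 * pi\<^sup>2 * \<bar>V x\<bar>" by (simp add: abs_mult)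
      have 3: "\<bar>R\<bar> \<le> (\<Sum>k\<in>{1..<M}. \<bar>P (real (Suc k) * x)\<bar> / (real (Suc k))\<^sup>2)"
        unfolding R_def by (rule order_trans[OF sum_abs]) simp
      show ?thesis using 1 2 3 by linarith
    qed
    have tail: "(\<Sum>k\<in>{1..<M}. 1 / (real (Suc k))\<^sup>2) \<le> pi\<^sup>2 / 6 - 1"
    proof -
      have "(\<Sum>k<M. 1 / (real (Suc k))\<^sup>2) \<le> (\<Sum>k. 1 / (real (Suc k))\<^sup>2)"
        by (rule sum_le_suminf[OF sums_summable[OF inverse_squares_sums_Suc]]) auto
      also have "\<dots> = pi\<^sup>2 / 6" by (rule sums_unique[OF inverse_squares_sums_Suc, symmetric])
      finally show ?thesis
        using M(1) by (simp add: lessThan_atLeast0 sum.atLeast_Suc_lessThan)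
    qed
    define W where "W x = (\<Sum>k\<in>{1..<M}. \<bar>P (real (Suc k) * x)\<bar> / (real (Suc k))\<^sup>2)" for x
    have cont_W: "continuous_on A W" for A
      unfolding W_def[abs_def] by (intro continuous_intros cont_P) auto
    have "integral {0..1} W = (\<Sum>k\<in>{1..<M}. integral {0..1} (\<lambda>x. \<bar>P (real (Suc k) * x)\<bar> / (real (Suc k))\<^sup>2))"
      unfolding W_def[abs_def]
      by (intro integral_sum integrable_continuous_interval continuous_intros cont_P) auto
    also have "\<dots> = T * (\<Sum>k\<in>{1..<M}. 1 / (real (Suc k))\<^sup>2)"
      by (simp only: divide_inverse integral_mult_left T_dil sum_distrib_left mult_1_left)
    also have "\<dots> \<le> T * (pi\<^sup>2 / 6 - 1)"
      by (intro mult_left_mono tail T_nonneg)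
    finally have W_int: "integral {0..1} W \<le> T * (pi\<^sup>2 / 6 - 1)" .
    have "T \<le> integral {0..1} (\<lambda>x. 4 * pi\<^sup>2 * \<bar>V x\<bar> + (W x + pi\<^sup>2 * e))"
      unfolding T_def using cont_P[of _ 1] pt[folded W_def]
      by (intro integral_le integrable_continuous_interval continuous_intros cont_V cont_W) auto
    moreover have "integral {0..1} (\<lambda>x. 4 * pi\<^sup>2 * \<bar>V x\<bar> + (W x + pi\<^sup>2 * e)) =
        integral {0..1} (\<lambda>x. 4 * pi\<^sup>2 * \<bar>V x\<bar>) + integral {0..1} (\<lambda>x. W x + pi\<^sup>2 * e)"
      by (intro integral_add integrable_continuous_interval continuous_intros cont_V cont_W)
    moreover have "integral {0..1} (\<lambda>x. W x + pi\<^sup>2 * e) = integral {0..1} W + integral {0..1} (\<lambda>x::real. pi\<^sup>2 * e)"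
      by (intro integral_add integrable_continuous_interval continuous_intros cont_W)
    moreover have "integral {0..1} (\<lambda>x::real. pi\<^sup>2 * e) = pi\<^sup>2 * e" by simp
    moreover have "integral {0..1} (\<lambda>x. 4 * pi\<^sup>2 * \<bar>V x\<bar>) = 4 * pi\<^sup>2 * integral {0..1} (\<lambda>x. \<bar>V x\<bar>)"
      by simp
    moreover have "4 * pi\<^sup>2 * integral {0..1} (\<lambda>x. \<bar>V x\<bar>) \<le> 4 * pi\<^sup>2 * (3 / 4 * e - 2 * \<mu>)"
      by (intro mult_left_mono absV) auto
    ultimately have "T \<le> 4 * pi\<^sup>2 * (3 / 4 * e - 2 * \<mu>) + (T * (pi\<^sup>2 / 6 - 1) + pi\<^sup>2 * e)"
      using W_int by linarith
    hence "T * (2 - pi\<^sup>2 / 6) \<le> 4 * pi\<^sup>2 * (- 2 * \<mu> + e)"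
      by (simp add: algebra_simps)
    thus ?thesis by (simp add: pos_divide_le_eq mult.commute)
  qed
  thus ?thesis unfolding T_def by (rule field_le_epsilon)
qed

section \<open>The Littlewood inequality of McGehee, Pigno and Smith\<close>

lemma has_integral_circle_mean:
  assumes "F holomorphic_on UNIV"
  shows "((\<lambda>x. F (cis (2 * pi * x))) has_integral F 0) {0..1}"
proof -
  have "((\<lambda>u. F u / (u - 0)) has_contour_integral (2 * of_real pi * \<i> * F 0)) (circlepath 0 1)"
    using assms by (intro Cauchy_integral_circlepath_simple) (auto intro: holomorphic_on_subset)
  hence "((\<lambda>x. 2 * of_real pi * \<i> * F (cis (2 * pi * x))) has_integral 2 * of_real pi * \<i> * F 0) {0..1}"
    unfolding has_contour_integral_def
  proof (rule has_integral_eq[rotated])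
    fix x :: real assume x: "x \<in> {0..1}"
    have "circlepath 0 1 x = cis (2 * pi * x)"
      by (simp add: circlepath cis_conv_exp mult_ac)
    moreover have "vector_derivative (circlepath 0 1) (at x within {0..1}) = 2 * of_real pi * \<i> * cis (2 * pi * x)"
      using x by (simp add: vector_derivative_circlepath01 cis_conv_exp mult_ac)
    ultimately show "F (circlepath 0 1 x) / (circlepath 0 1 x - 0) * vector_derivative (circlepath 0 1) (at x within {0..1})
        = 2 * of_real pi * \<i> * F (cis (2 * pi * x))"
      by simp
  qed
  from has_integral_mult_right[OF this, of "1 / (2 * of_real pi * \<i>)"] show ?thesis
    by simp
qed

section \<open>Characters and mean squares on the circle\<close>

definition fourier_char :: "int \<Rightarrow> real \<Rightarrow> complex" where
  "fourier_char n x = cis (2 * pi * of_int n * x)"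

lemma fourier_char_mult: "fourier_char m x * fourier_char n x = fourier_char (m + n) x"
  by (simp add: fourier_char_def cis_mult algebra_simps)

lemma cnj_fourier_char: "cnj (fourier_char n x) = fourier_char (- n) x"
  by (simp add: fourier_char_def cis_cnj)

lemma norm_fourier_char [simp]: "norm (fourier_char n x) = 1"
  by (simp add: fourier_char_def)

lemma continuous_on_fourier_char [continuous_intros]: "continuous_on S (fourier_char n)"
  unfolding fourier_char_def[abs_def] by (intro continuous_intros)

lemma fourier_char_powi: "fourier_char n x = cis (2 * pi * x) powi n"
  by (simp add: fourier_char_def cis_power_int mult_ac)

lemma fourier_char_power: "fourier_char (int n) x = cis (2 * pi * x) ^ n"
  by (simp add: fourier_char_powi)

lemma has_integral_fourier_char:
  "(fourier_char n has_integral (if n = 0 then 1 else 0)) {0..1}"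
proof -
  have pos: "(fourier_char (int k) has_integral (0 ^ k)) {0..1}" for k
    using has_integral_circle_mean[of "\<lambda>w. w ^ k"]
    by (simp add: fourier_char_power[abs_def] holomorphic_intros)
  show ?thesis
  proof (cases "n \<ge> 0")
    case True
    thus ?thesis using pos[of "nat n"] by (cases "n = 0") (auto simp: zero_power)
  next
    case False
    have "((\<lambda>x. cnj (fourier_char (int (nat (- n))) x)) has_integral cnj (0 ^ nat (- n))) {0..1}"
      using has_integral_linear[OF pos bounded_linear_cnj] by (simp only: o_def)
    thus ?thesis using False by (simp add: cnj_fourier_char zero_power)
  qed
qed

lemma has_integral_norm_square_char_sum:
  assumes "finite S"
  shows "((\<lambda>x. (norm (of_real c * (\<Sum>n\<in>S. fourier_char n x)))\<^sup>2) has_integral c\<^sup>2 * card S) {0..1}"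
proof -
  have eq: "complex_of_real ((norm (of_real c * (\<Sum>n\<in>S. fourier_char n x)))\<^sup>2)
      = (\<Sum>m\<in>S. \<Sum>n\<in>S. of_real (c\<^sup>2) * fourier_char (m - n) x)" for x
  proof -
    have "complex_of_real ((norm (of_real c * (\<Sum>n\<in>S. fourier_char n x)))\<^sup>2)
      = (of_real c * (\<Sum>n\<in>S. fourier_char n x)) * cnj (of_real c * (\<Sum>n\<in>S. fourier_char n x))"
      by (simp only: complex_norm_square)
    also have "\<dots> = (of_real c)\<^sup>2 * ((\<Sum>m\<in>S. fourier_char m x) * (\<Sum>n\<in>S. fourier_char (- n) x))"
      by (simp add: cnj_fourier_char power2_eq_square)
    also have "(\<Sum>m\<in>S. fourier_char m x) * (\<Sum>n\<in>S. fourier_char (- n) x) = (\<Sum>m\<in>S. \<Sum>n\<in>S. fourier_char (m - n) x)"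
      by (simp add: sum_product fourier_char_mult)
    finally show ?thesis by (simp add: sum_distrib_left)
  qed
  have "((\<lambda>x. complex_of_real ((norm (of_real c * (\<Sum>n\<in>S. fourier_char n x)))\<^sup>2)) has_integral
      (\<Sum>m\<in>S. \<Sum>n\<in>S. of_real (c\<^sup>2) * (if m - n = 0 then 1 else 0))) {0..1}"
    unfolding eq using assms
    by (intro has_integral_sum has_integral_mult_right has_integral_fourier_char)
  also have "(\<Sum>m\<in>S. \<Sum>n\<in>S. complex_of_real (c\<^sup>2) * (if m - n = 0 then 1 else 0)) = of_real (c\<^sup>2 * card S)"
  proof -
    have "(\<Sum>n\<in>S. complex_of_real (c\<^sup>2) * (if m - n = 0 then 1 else 0)) = of_real (c\<^sup>2)" if "m \<in> S" for m
    proof -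
      have "(\<Sum>n\<in>S. complex_of_real (c\<^sup>2) * (if m - n = 0 then 1 else 0)) = (\<Sum>n\<in>S. if m = n then complex_of_real (c\<^sup>2) else 0)"
        by (intro sum.cong) auto
      thus ?thesis using assms that by simp
    qed
    thus ?thesis by simp
  qed
  finally have "((\<lambda>x. complex_of_real ((norm (of_real c * (\<Sum>n\<in>S. fourier_char n x)))\<^sup>2)) has_integral
      complex_of_real (c\<^sup>2 * card S)) {0..1}" .
  from has_integral_Re[OF this] show ?thesis by (simp only: Re_complex_of_real)
qed

text \<open>The mean of p^2 is p(0)^2, which is nonnegative because p(0) is real, and Re (p^2) = 2
  (Re p)^2 - |p|^2. This is the L^2 bound for the conjugate function.\<close>

lemma integral_norm_square_le_Re:
  assumes hol: "p holomorphic_on UNIV" and im: "Im (p 0) = 0"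
  shows "integral {0..1} (\<lambda>x. (norm (p (cis (2 * pi * x))))\<^sup>2) \<le> 2 * integral {0..1} (\<lambda>x. (Re (p (cis (2 * pi * x))))\<^sup>2)"
proof -
  have cont: "continuous_on {0..1} (\<lambda>x. p (cis (2 * pi * x)))"
    by (intro continuous_on_compose2[OF holomorphic_on_imp_continuous_on[OF hol]] continuous_intros) auto
  have "((\<lambda>x. (p (cis (2 * pi * x)))\<^sup>2) has_integral (p 0)\<^sup>2) {0..1}"
    using hol by (intro has_integral_circle_mean holomorphic_intros)
  hence "((\<lambda>x. Re ((p (cis (2 * pi * x)))\<^sup>2)) has_integral Re ((p 0)\<^sup>2)) {0..1}"
    using has_integral_Re by blast
  hence "integral {0..1} (\<lambda>x. Re ((p (cis (2 * pi * x)))\<^sup>2)) = Re ((p 0)\<^sup>2)"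
    by (rule integral_unique)
  also have "\<dots> \<ge> 0" using im by (simp add: power2_eq_square)
  finally have "0 \<le> integral {0..1} (\<lambda>x. Re ((p (cis (2 * pi * x)))\<^sup>2))" .
  also have "\<dots> = integral {0..1} (\<lambda>x. 2 * (Re (p (cis (2 * pi * x))))\<^sup>2 - (norm (p (cis (2 * pi * x))))\<^sup>2)"
    by (intro integral_cong) (simp add: cmod_power2 Re_power2)
  also have "\<dots> = integral {0..1} (\<lambda>x. 2 * (Re (p (cis (2 * pi * x))))\<^sup>2) - integral {0..1} (\<lambda>x. (norm (p (cis (2 * pi * x))))\<^sup>2)"
    by (intro integral_diff integrable_continuous_interval continuous_intros cont)
  finally show ?thesis by simp
qed

section \<open>Real parts of polynomials on the unit circle\<close>

text \<open>These are the real trigonometric polynomials. Agreement is asked on the circle only: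
  there the class is closed under products, while inside the disc a product of harmonic functions is
  in general not harmonic.\<close>

definition circle_harmonic :: "(complex \<Rightarrow> real) \<Rightarrow> bool" where
  "circle_harmonic f \<longleftrightarrow> (\<exists>p :: complex poly. \<forall>z\<in>sphere 0 1. f z = Re (poly p z))"

lemma circle_harmonic_add:
  assumes "circle_harmonic f" "circle_harmonic g"
  shows "circle_harmonic (\<lambda>z. f z + g z)"
proof -
  obtain p q where "\<forall>z\<in>sphere 0 1. f z = Re (poly p z)" "\<forall>z\<in>sphere 0 1. g z = Re (poly q z)"
    using assms by (auto simp: circle_harmonic_def)
  thus ?thesis unfolding circle_harmonic_def by (intro exI[of _ "p + q"]) auto
qed

lemma circle_harmonic_poly: "circle_harmonic (\<lambda>z. Re (poly p z))"
  by (auto simp: circle_harmonic_def)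

lemma circle_harmonic_sum:
  "finite I \<Longrightarrow> (\<And>i. i \<in> I \<Longrightarrow> circle_harmonic (f i)) \<Longrightarrow> circle_harmonic (\<lambda>z. \<Sum>i\<in>I. f i z)"
  by (induction I rule: finite_induct)
     (use circle_harmonic_poly[of 0] in \<open>auto intro: circle_harmonic_add\<close>)

text \<open>On the circle conjugation inverts z, so the factor z^m * cnj z^n in Re u * Re v = Re (u
  v / 2 + u cnj v / 2) is again a monomial once the larger exponent is put first.\<close>

lemma circle_harmonic_mult_monom:
  "circle_harmonic (\<lambda>z. Re (a * z ^ m) * Re (b * z ^ n))"
proof -
  have *: "circle_harmonic (\<lambda>z. Re (a * z ^ m) * Re (b * z ^ n))" if "n \<le> m" for a b m n
    unfolding circle_harmonic_def
  proof (intro exI[of _ "monom (a * b / 2) (m + n) + monom (a * cnj b / 2) (m - n)"] ballI)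
    fix z :: complex assume "z \<in> sphere 0 1"
    hence "z * cnj z = 1" by (simp flip: complex_norm_square)
    hence 1: "z ^ n * cnj z ^ n = 1" by (metis power_mult_distrib power_one)
    have "z ^ m * cnj z ^ n = z ^ (m - n) * (z ^ n * cnj z ^ n)"
      using that by (simp flip: power_add mult.assoc)
    hence 2: "z ^ m * cnj z ^ n = z ^ (m - n)" using 1 by simp
    have "Re u * Re v = Re (u * v / 2 + u * cnj v / 2)" for u v
      by (simp add: field_simps)
    from this[of "a * z ^ m" "b * z ^ n"]
    have "Re (a * z ^ m) * Re (b * z ^ n) = Re (a * b / 2 * (z ^ m * z ^ n) + a * cnj b / 2 * (z ^ m * cnj z ^ n))"
      by (simp add: mult_ac)
    thus "Re (a * z ^ m) * Re (b * z ^ n) = Re (poly (monom (a * b / 2) (m + n) + monom (a * cnj b / 2) (m - n)) z)"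
      by (simp only: 2 poly_add poly_monom power_add)
  qed
  show ?thesis
    using *[of n m a b] *[of m n b a] by (cases "n \<le> m") (auto simp: mult.commute)
qed

lemma circle_harmonic_mult:
  assumes "circle_harmonic f" "circle_harmonic g"
  shows "circle_harmonic (\<lambda>z. f z * g z)"
proof -
  obtain p q where pq: "\<forall>z\<in>sphere 0 1. f z = Re (poly p z)" "\<forall>z\<in>sphere 0 1. g z = Re (poly q z)"
    using assms by (auto simp: circle_harmonic_def)
  have "Re (poly p z) * Re (poly q z)
      = (\<Sum>i\<le>degree p. \<Sum>j\<le>degree q. Re (coeff p i * z ^ i) * Re (coeff q j * z ^ j))" for z
    by (simp only: poly_altdef Re_sum sum_product)
  moreover have "circle_harmonic (\<lambda>z. \<Sum>i\<le>degree p. \<Sum>j\<le>degree q. Re (coeff p i * z ^ i) * Re (coeff q j * z ^ j))"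
    by (intro circle_harmonic_sum circle_harmonic_mult_monom) auto
  ultimately show ?thesis using pq by (simp add: circle_harmonic_def)
qed

lemma real_polynomial_function_circle_harmonic:
  assumes "real_polynomial_function f"
  shows "circle_harmonic f"
  using assms
proof (induction rule: real_polynomial_function.induct)
  case (linear f)
  have "f z = Re (poly [:0, Complex (f 1) (- f \<i>):] z)" for z
  proof -
    have "f (Re z *\<^sub>R 1 + Im z *\<^sub>R \<i>) = Re z * f 1 + Im z * f \<i>"
      using bounded_linear.linear[OF linear] by (simp only: linear_add linear_cmul real_scaleR_def)
    moreover have "Re z *\<^sub>R 1 + Im z *\<^sub>R \<i> = z" by (simp add: complex_eq_iff)
    ultimately have "f z = Re z * f 1 + Im z * f \<i>" by simp
    thus ?thesis by (simp add: mult.commute)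
  qed
  thus ?case unfolding circle_harmonic_def by blast
next
  case (const c)
  show ?case unfolding circle_harmonic_def by (intro exI[of _ "[:of_real c:]"]) auto
qed (auto intro: circle_harmonic_add circle_harmonic_mult)

text \<open>Stone-Weierstrass in the two real coordinates, followed by rewriting the approximant as
  a real part. Subtracting an imaginary constant makes p(0) real and leaves Re p unchanged;
  \<open>integral_norm_square_le_Re\<close> relies on this normalisation.\<close>

lemma circle_approx_Re_entire:
  assumes g: "continuous_on (sphere 0 1) (g :: complex \<Rightarrow> real)" and "e > 0"
  obtains p where "p holomorphic_on UNIV" "Im (p 0) = 0"
    "\<And>z. norm z = 1 \<Longrightarrow> \<bar>g z - Re (p z)\<bar> < e"
proof -
  obtain h where h: "real_polynomial_function h" "\<And>z. z \<in> sphere 0 1 \<Longrightarrow> \<bar>g z - h z\<bar> < e"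
    using Stone_Weierstrass_real_polynomial_function[OF compact_sphere g \<open>e > 0\<close>] by metis
  obtain p where p: "\<forall>z\<in>sphere 0 1. h z = Re (poly p z)"
    using real_polynomial_function_circle_harmonic[OF h(1)] by (auto simp: circle_harmonic_def)
  show ?thesis
  proof
    show "(\<lambda>z. poly p z - of_real (Im (poly p 0)) * \<i>) holomorphic_on UNIV"
      by (intro holomorphic_intros)
  qed (use h(2) p in auto)
qed

text \<open>The right half plane is convex and exp (-z) has derivative of modulus at most 1 on
  it.\<close>

lemma norm_one_minus_exp_neg_le:
  assumes "0 \<le> Re w"
  shows "norm (exp (- w) - 1) \<le> norm w"
proof -
  have "norm (exp (- w) - exp (- 0)) \<le> 1 * norm (w - 0)"
  proof (rule field_differentiable_bound[where S = "{z. 0 \<le> Re z}"])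
    show "convex {z. 0 \<le> Re z}" by (rule convex_halfspace_Re_ge)
    show "((\<lambda>z. exp (- z)) has_field_derivative - exp (- z)) (at z within {z. 0 \<le> Re z})" for z
      by (auto intro!: derivative_eq_intros)
  qed (use assms in auto)
  thus ?thesis by simp
qed

lemma sum_powers_half_le: "(\<Sum>i\<in>{j<..J}. (1/2::real) ^ i) \<le> (1/2) ^ j"
proof (cases "j \<le> J")
  case True
  hence "(\<Sum>i\<in>{j<..J}. (1/2::real) ^ i) = (1/2) ^ j - (1/2) ^ J"
  proof (induction J rule: dec_induct)
    case (step n)
    have "{j<..Suc n} = insert (Suc n) {j<..n}" using step.hyps by auto
    thus ?case using step by simp
  qed simp
  thus ?thesis by simp
qed simp

lemma sum_powers_quarter_le: "(\<Sum>i\<in>{l..J}. (1/4::real) ^ i) \<le> 4/3 * (1/4) ^ l"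
proof (cases "l \<le> J")
  case True
  hence "(\<Sum>i\<in>{l..J}. (1/4::real) ^ i) = 4/3 * ((1/4) ^ l - (1/4) ^ Suc J)"
    by (induction J rule: dec_induct) (auto simp: atLeastAtMostSuc_conv)
  thus ?thesis by simp
qed simp

text \<open>Cauchy-Schwarz, by integrating a pointwise weighted AM-GM inequality whose weights are
  tuned to the given bounds.\<close>

lemma integral_norm_mult_le:
  fixes f h :: "real \<Rightarrow> complex"
  assumes "continuous_on {0..1} f" "continuous_on {0..1} h" "0 < a" "0 < b"
    and "integral {0..1} (\<lambda>x. (norm (f x))\<^sup>2) \<le> a\<^sup>2" "integral {0..1} (\<lambda>x. (norm (h x))\<^sup>2) \<le> b\<^sup>2"
  shows "integral {0..1} (\<lambda>x. norm (f x) * norm (h x)) \<le> a * b"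
proof -
  have amgm: "norm (f x) * norm (h x) \<le> b / (2 * a) * (norm (f x))\<^sup>2 + a / (2 * b) * (norm (h x))\<^sup>2" for x
  proof -
    have "0 \<le> (b * norm (f x) - a * norm (h x))\<^sup>2" by simp
    thus ?thesis using assms(3,4) by (simp add: field_simps power2_eq_square)
  qed
  have "integral {0..1} (\<lambda>x. norm (f x) * norm (h x))
      \<le> integral {0..1} (\<lambda>x. b / (2 * a) * (norm (f x))\<^sup>2 + a / (2 * b) * (norm (h x))\<^sup>2)"
    by (intro integral_le integrable_continuous_interval continuous_intros assms(1,2) amgm)
  also have "\<dots> = integral {0..1} (\<lambda>x. b / (2 * a) * (norm (f x))\<^sup>2) + integral {0..1} (\<lambda>x. a / (2 * b) * (norm (h x))\<^sup>2)"
    by (intro integral_add integrable_continuous_interval continuous_intros assms(1,2))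
  also have "\<dots> = b / (2 * a) * integral {0..1} (\<lambda>x. (norm (f x))\<^sup>2) + a / (2 * b) * integral {0..1} (\<lambda>x. (norm (h x))\<^sup>2)"
    by simp
  also have "\<dots> \<le> b / (2 * a) * a\<^sup>2 + a / (2 * b) * b\<^sup>2"
    using assms by (intro add_mono mult_left_mono) auto
  also have "\<dots> = a * b" using assms(3,4) by (simp add: field_simps power2_eq_square)
  finally show ?thesis .
qed

text \<open>The induction step for the sup bound of the test function. The bound 5 fits the damping
  rate 1/4 because 1 / (1 + u/4) <= 1 - u/5 on [0,1], with equality at u = 1.\<close>

lemma exp_neg_quarter_le:
  fixes u :: real
  assumes "0 \<le> u" "u \<le> 1"
  shows "5 * exp (- (u / 4)) + u \<le> 5"
proof -
  have "1 + u / 4 \<le> exp (u / 4)" by (rule exp_ge_add_one_self)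
  hence "exp (- (u / 4)) \<le> 1 / (1 + u / 4)"
    using assms by (simp add: exp_minus field_simps)
  also have "\<dots> \<le> 1 - u / 5"
    using assms mult_left_mono[of u 1 u] by (simp add: field_simps)
  finally show ?thesis by simp
qed

text \<open>In the construction, \<open>h l\<close> is the boundary value of an entire function whose real part is slightly
  larger than the modulus of the block \<open>f l\<close>.  The factor \<open>exp (- h l / 4)\<close> makes room for adding \<open>f l\<close>
  without exceeding the bound \<open>5\<close>, and, as it has only nonnegative frequencies, it moves the earlier blocks
  (which have the larger frequencies) away from the later ones.  Replacing the modulus by a polynomial keeps
  everything continuous and avoids boundary values of bounded analytic functions.\<close>

lemma littlewood_test_function:
  fixes S :: "nat \<Rightarrow> int set" and J :: nat
  assumes fin: "\<And>l. finite (S l)" and card: "\<And>l. card (S l) \<le> 4 ^ l"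
    and ord: "\<And>l l' m n. l < l' \<Longrightarrow> m \<in> S l \<Longrightarrow> n \<in> S l' \<Longrightarrow> n < m"
  obtains \<Phi> :: "real \<Rightarrow> complex" where "continuous_on {0..1} \<Phi>" "\<And>x. norm (\<Phi> x) \<le> 5"
    "\<And>l n. l \<le> J \<Longrightarrow> n \<in> S l \<Longrightarrow> (1/4) ^ l / 2 \<le> Re (integral {0..1} (\<lambda>x. \<Phi> x * fourier_char (- n) x))"
proof -
  \<comment> \<open>The weight 4^(-l) makes |f l| <= 1 and the mean square at most 4^(-l); the decay
    of the latter is what makes the interaction between blocks summable.\<close>
  define f where "f l x = of_real ((1/4) ^ l) * (\<Sum>n\<in>S l. fourier_char n x)" for l x
  have cont_f: "continuous_on {0..1} (f l)" for l
    unfolding f_def[abs_def] by (intro continuous_intros)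
  have card': "real (card (S l)) \<le> 4 ^ l" for l
    using card[of l] by (simp flip: of_nat_le_iff)
  have f_le: "norm (f l x) \<le> 1" for l x
  proof -
    have "norm (\<Sum>n\<in>S l. fourier_char n x) \<le> (\<Sum>n\<in>S l. norm (fourier_char n x))"
      by (rule norm_sum)
    also have "\<dots> = real (card (S l))" by simp
    also have "\<dots> \<le> 4 ^ l" by (rule card')
    finally have "norm (f l x) \<le> (1/4) ^ l * 4 ^ l"
      unfolding f_def norm_mult norm_of_real by (intro mult_mono) auto
    thus ?thesis by (simp flip: power_mult_distrib)
  qed
  have f_int: "integral {0..1} (\<lambda>x. (norm (f l x))\<^sup>2) \<le> (1/4) ^ l" for l
  proof -
    have "integral {0..1} (\<lambda>x. (norm (f l x))\<^sup>2) = ((1/4) ^ l)\<^sup>2 * card (S l)"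
      unfolding f_def by (intro integral_unique has_integral_norm_square_char_sum fin)
    also have "\<dots> \<le> ((1/4) ^ l)\<^sup>2 * 4 ^ l"
      using card'[of l] by (intro mult_left_mono) auto
    also have "\<dots> = (1/4) ^ l" by (simp add: power2_eq_square flip: power_mult_distrib)
    finally show ?thesis .
  qed
  have "\<exists>p. p holomorphic_on UNIV \<and> Im (p 0) = 0 \<and>
      (\<forall>x. norm (f l x) \<le> Re (p (cis (2 * pi * x))) \<and> Re (p (cis (2 * pi * x))) \<le> norm (f l x) + (1/4) ^ l / 24)" for l
  proof -
    \<comment> \<open>Approximating |f l| + e within e places the real part between |f l| and |f l|
      + 2 e, and 2 e = 4^(-l) / 24.\<close>
    define e :: real where "e = (1/4) ^ l / 48"
    have e: "e > 0" by (simp add: e_def)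
    have "continuous_on (sphere 0 1) (\<lambda>z::complex. \<Sum>n\<in>S l. z powi n)"
      by (intro continuous_on_sum continuous_on_power_int continuous_on_id) auto
    hence cont: "continuous_on (sphere 0 1) (\<lambda>z::complex. norm (of_real ((1/4) ^ l) * (\<Sum>n\<in>S l. z powi n)) + e)"
      by (intro continuous_on_add continuous_on_norm continuous_on_mult continuous_on_const)
    obtain p where p: "p holomorphic_on UNIV" "Im (p 0) = 0"
      "\<And>z. norm z = 1 \<Longrightarrow> \<bar>norm (of_real ((1/4) ^ l) * (\<Sum>n\<in>S l. z powi n)) + e - Re (p z)\<bar> < e"
      by (rule circle_approx_Re_entire[OF cont e]) (rule that)
    have "norm (f l x) \<le> Re (p (cis (2 * pi * x))) \<and> Re (p (cis (2 * pi * x))) \<le> norm (f l x) + (1/4) ^ l / 24" for x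
    proof -
      have "\<bar>norm (f l x) + e - Re (p (cis (2 * pi * x)))\<bar> < e"
        unfolding f_def fourier_char_powi by (rule p(3)[OF norm_cis])
      hence "norm (f l x) + e - Re (p (cis (2 * pi * x))) < e" "- (norm (f l x) + e - Re (p (cis (2 * pi * x)))) < e"
        by (simp_all only: abs_less_iff)
      moreover have "(1/4) ^ l / 24 = e + e" by (simp add: e_def)
      ultimately show ?thesis by linarith
    qed
    with p(1,2) show ?thesis by blast
  qed
  then obtain p where p: "\<And>l. p l holomorphic_on UNIV" "\<And>l. Im (p l 0) = 0"
    "\<And>l x. norm (f l x) \<le> Re (p l (cis (2 * pi * x)))"
    "\<And>l x. Re (p l (cis (2 * pi * x))) \<le> norm (f l x) + (1/4) ^ l / 24"
    by metis
  define h where "h l x = p l (cis (2 * pi * x))" for l x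
  have cont_h: "continuous_on {0..1} (h l)" for l
    unfolding h_def[abs_def]
    by (intro continuous_on_compose2[OF holomorphic_on_imp_continuous_on[OF p(1)]] continuous_intros) auto
  have Re_h: "0 \<le> Re (h l x)" "norm (f l x) \<le> Re (h l x)" for l x
    using p(3)[of l x] norm_ge_zero[of "f l x"] unfolding h_def by linarith+
  \<comment> \<open>9/4 = 2 * (1 + 1/8): the 2 comes from passing to the conjugate part, and the 1/8
    covers 1/12 + 1/576 from squaring the approximation error. Its root 3/2 enters
    \<open>fh\<close>.\<close>
  have h_int: "integral {0..1} (\<lambda>x. (norm (h l x))\<^sup>2) \<le> 9/4 * (1/4) ^ l" for l
  proof -
    have q: "(1/4 :: real) ^ l \<le> 1" by (simp add: power_le_one)
    have pt: "(Re (h l x))\<^sup>2 \<le> (norm (f l x))\<^sup>2 + (1/4) ^ l / 8" for x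
    proof -
      have "(Re (h l x))\<^sup>2 \<le> (norm (f l x) + (1/4) ^ l / 24)\<^sup>2"
        using p(4)[of l x] Re_h(1)[of l x] by (intro power_mono) (auto simp: h_def)
      also have "\<dots> = (norm (f l x))\<^sup>2 + ((1/4) ^ l / 12) * norm (f l x) + (1/4) ^ l / 24 * ((1/4) ^ l / 24)"
        by (simp add: power2_eq_square algebra_simps)
      also have "\<dots> \<le> (norm (f l x))\<^sup>2 + ((1/4) ^ l / 12) * 1 + (1/4) ^ l / 24 * (1 / 24)"
        using f_le[of l x] q by (intro add_mono mult_left_mono) auto
      also have "\<dots> \<le> (norm (f l x))\<^sup>2 + (1/4) ^ l / 8"
        using zero_le_power[of "1/4::real" l] by linarith
      finally show ?thesis .
    qed
    have "integral {0..1} (\<lambda>x. (norm (h l x))\<^sup>2) \<le> 2 * integral {0..1} (\<lambda>x. (Re (h l x))\<^sup>2)"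
      unfolding h_def by (rule integral_norm_square_le_Re[OF p(1,2)])
    also have "integral {0..1} (\<lambda>x. (Re (h l x))\<^sup>2) \<le> integral {0..1} (\<lambda>x. (norm (f l x))\<^sup>2 + (1/4) ^ l / 8)"
      by (intro integral_le integrable_continuous_interval continuous_intros cont_h cont_f pt)
    also have "\<dots> = integral {0..1} (\<lambda>x. (norm (f l x))\<^sup>2) + integral {0..1} (\<lambda>x::real. (1/4) ^ l / 8)"
      by (intro integral_add integrable_continuous_interval continuous_intros cont_f)
    also have "\<dots> \<le> (1/4) ^ l + (1/4) ^ l / 8" using f_int[of l] by simp
    finally show ?thesis by simp
  qed
  \<comment> \<open>\<open>E J j\<close> collects the damping factors that block j receives from all
    later blocks, so that \<open>\<Phi>\<close> solves the recursion
    \<open>\<Phi>_Suc\<close>.\<close>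
  define E where "E J j x = exp (- ((\<Sum>i\<in>{j<..J}. h i x) / 4))" for J j :: nat and x
  define \<Phi> where "\<Phi> J x = (\<Sum>j\<le>J. f j x * E J j x)" for J x
  have cont_E: "continuous_on {0..1} (E J j)" for J j
    unfolding E_def[abs_def] by (intro continuous_intros cont_h) auto
  have \<Phi>_Suc: "\<Phi> (Suc J) x = \<Phi> J x * exp (- (h (Suc J) x / 4)) + f (Suc J) x" for J x
  proof -
    have "E (Suc J) j x = E J j x * exp (- (h (Suc J) x / 4))" if "j \<le> J" for j
    proof -
      have "{j<..Suc J} = insert (Suc J) {j<..J}" using that by auto
      hence "(\<Sum>i\<in>{j<..Suc J}. h i x) = h (Suc J) x + (\<Sum>i\<in>{j<..J}. h i x)" by simp
      thus ?thesis unfolding E_def by (simp add: add_divide_distrib mult.commute flip: exp_add)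
    qed
    hence "(\<Sum>j\<le>J. f j x * E (Suc J) j x) = (\<Sum>j\<le>J. f j x * E J j x * exp (- (h (Suc J) x / 4)))"
      by (intro sum.cong) (simp_all add: mult.assoc)
    also have "\<dots> = \<Phi> J x * exp (- (h (Suc J) x / 4))"
      unfolding \<Phi>_def by (simp only: sum_distrib_right)
    finally have "(\<Sum>j\<le>J. f j x * E (Suc J) j x) = \<Phi> J x * exp (- (h (Suc J) x / 4))" .
    thus ?thesis by (simp add: \<Phi>_def E_def)
  qed
  have \<Phi>_le: "norm (\<Phi> J x) \<le> 5" for J x
  proof (induction J)
    case 0
    show ?case using f_le[of 0 x] by (simp add: \<Phi>_def E_def)
  next
    case (Suc J)
    have "norm (\<Phi> (Suc J) x) \<le> norm (\<Phi> J x) * norm (exp (- (h (Suc J) x / 4))) + norm (f (Suc J) x)"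
      unfolding \<Phi>_Suc norm_mult[symmetric] by (rule norm_triangle_ineq)
    also have "\<dots> \<le> 5 * exp (- (norm (f (Suc J) x) / 4)) + norm (f (Suc J) x)"
      using Suc Re_h(2)[of "Suc J" x] by (intro add_mono mult_mono) auto
    also have "\<dots> \<le> 5" by (rule exp_neg_quarter_le) (auto simp: f_le)
    finally show ?case .
  qed
  have E_le: "norm (E J j x - 1) \<le> (\<Sum>i\<in>{j<..J}. norm (h i x)) / 4" for j x
  proof -
    have "norm (E J j x - 1) \<le> norm ((\<Sum>i\<in>{j<..J}. h i x) / 4)"
      unfolding E_def using Re_h(1)
      by (intro norm_one_minus_exp_neg_le) (auto intro!: sum_nonneg)
    also have "\<dots> \<le> (\<Sum>i\<in>{j<..J}. norm (h i x)) / 4"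
      using norm_sum[of "\<lambda>i. h i x" "{j<..J}"] by (simp add: norm_divide)
    finally show ?thesis .
  qed
  have fh: "integral {0..1} (\<lambda>x. norm (f j x) * norm (h i x)) \<le> 3/2 * (1/2) ^ j * (1/2) ^ i" for i j
  proof -
    have "((1/2::real) ^ k)\<^sup>2 = (1/4) ^ k" for k
      by (simp add: power2_eq_square flip: power_mult_distrib)
    hence "integral {0..1} (\<lambda>x. norm (f j x) * norm (h i x)) \<le> (1/2) ^ j * (3/2 * (1/2) ^ i)"
      using f_int[of j] h_int[of i]
      by (intro integral_norm_mult_le cont_f cont_h) (auto simp: power_mult_distrib power_divide)
    thus ?thesis by (simp add: mult_ac)
  qed
  \<comment> \<open>The damping perturbs the block by |E - 1| <= sum |h i| / 4 over i > j. With
    \<open>fh\<close> this costs 1/4 * 3/2 * 2^(-j) times the sum of 2^(-i) over i > j.\<close>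
  have err: "norm (integral {0..1} (\<lambda>x. f j x * (E J j x - 1) * fourier_char n x)) \<le> 3/8 * (1/4) ^ j" for j n
  proof -
    have "norm (integral {0..1} (\<lambda>x. f j x * (E J j x - 1) * fourier_char n x))
        \<le> integral {0..1} (\<lambda>x. \<Sum>i\<in>{j<..J}. 1/4 * (norm (f j x) * norm (h i x)))"
    proof (intro integral_norm_bound_integral integrable_continuous_interval continuous_intros cont_f cont_h cont_E)
      fix x
      have "norm (f j x * (E J j x - 1) * fourier_char n x) = norm (f j x) * norm (E J j x - 1)"
        by (simp add: norm_mult)
      also have "\<dots> \<le> norm (f j x) * ((\<Sum>i\<in>{j<..J}. norm (h i x)) / 4)"
        by (intro mult_left_mono E_le) auto
      also have "\<dots> = (\<Sum>i\<in>{j<..J}. 1/4 * (norm (f j x) * norm (h i x)))"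
        by (simp add: sum_distrib_left sum_divide_distrib)
      finally show "norm (f j x * (E J j x - 1) * fourier_char n x) \<le> (\<Sum>i\<in>{j<..J}. 1/4 * (norm (f j x) * norm (h i x)))" .
    qed
    also have "\<dots> = (\<Sum>i\<in>{j<..J}. integral {0..1} (\<lambda>x. 1/4 * (norm (f j x) * norm (h i x))))"
      by (intro integral_sum integrable_continuous_interval continuous_intros cont_f cont_h) auto
    also have "\<dots> \<le> (\<Sum>i\<in>{j<..J}. 1/4 * (3/2 * (1/2) ^ j * (1/2) ^ i))"
      unfolding integral_mult_right by (intro sum_mono mult_left_mono fh) auto
    also have "\<dots> = 3/8 * (1/2) ^ j * (\<Sum>i\<in>{j<..J}. (1/2) ^ i)"
      by (simp add: sum_distrib_left)
    also have "\<dots> \<le> 3/8 * (1/2) ^ j * (1/2) ^ j"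
      by (intro mult_left_mono sum_powers_half_le) auto
    also have "\<dots> = 3/8 * (1/4) ^ j" by (simp flip: power_mult_distrib)
    finally show ?thesis .
  qed
  \<comment> \<open>Frequencies of an earlier block exceed n, and \<open>E\<close> only adds
    nonnegative ones. The integrand is thus a combination of boundary values of entire functions
    vanishing at 0.\<close>
  have zero: "integral {0..1} (\<lambda>x. f j x * E J j x * fourier_char (- n) x) = 0" if "j < l" "n \<in> S l" for j l n
  proof -
    have "((\<lambda>x. \<Sum>m\<in>S j. of_real ((1/4) ^ j) * (fourier_char (m - n) x * E J j x)) has_integral
        (\<Sum>m\<in>S j. of_real ((1/4) ^ j) * 0)) {0..1}"
    proof (intro has_integral_sum has_integral_mult_right fin)
      fix m assume "m \<in> S j"
      with ord that have mn: "n < m" by blast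
      define F where "F w = w ^ nat (m - n) * exp (- ((\<Sum>i\<in>{j<..J}. p i w) / 4))" for w :: complex
      have "F holomorphic_on UNIV"
        unfolding F_def[abs_def] by (intro holomorphic_intros p(1)) auto
      from has_integral_circle_mean[OF this]
      have "((\<lambda>x. F (cis (2 * pi * x))) has_integral 0) {0..1}"
        using mn by (simp add: F_def zero_power)
      moreover have "F (cis (2 * pi * x)) = fourier_char (m - n) x * E J j x" for x
        using mn by (simp add: F_def E_def h_def flip: fourier_char_power)
      ultimately show "((\<lambda>x. fourier_char (m - n) x * E J j x) has_integral 0) {0..1}" by simp
    qed
    moreover have "(\<Sum>m\<in>S j. of_real ((1/4) ^ j) * (fourier_char (m - n) x * E J j x)) = f j x * E J j x * fourier_char (- n) x" for x
      by (simp add: f_def sum_distrib_left sum_distrib_right mult_ac fourier_char_mult[of _ x "- n", simplified, symmetric])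
    ultimately show ?thesis by (simp add: integral_unique)
  qed
  have main: "integral {0..1} (\<lambda>x. f j x * fourier_char (- n) x) = (if j = l then (1/4) ^ l else 0)" if "n \<in> S l" for j l n
  proof -
    have "((\<lambda>x. \<Sum>m\<in>S j. of_real ((1/4) ^ j) * fourier_char (m - n) x) has_integral
        (\<Sum>m\<in>S j. of_real ((1/4) ^ j) * (if m - n = 0 then 1 else 0))) {0..1}"
      by (intro has_integral_sum has_integral_mult_right fin has_integral_fourier_char)
    moreover have "(\<Sum>m\<in>S j. of_real ((1/4) ^ j) * fourier_char (m - n) x) = f j x * fourier_char (- n) x" for x
      by (simp add: f_def sum_distrib_left sum_distrib_right mult_ac fourier_char_mult[of _ x "- n", simplified, symmetric])
    moreover have "(\<Sum>m\<in>S j. of_real ((1/4) ^ j) * (if m - n = 0 then 1 else 0)) = (if n \<in> S j then (1/4::complex) ^ j else 0)"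
    proof -
      have "(\<Sum>m\<in>S j. of_real ((1/4) ^ j) * (if m - n = 0 then 1 else 0)) = (\<Sum>m\<in>S j. if n = m then (1/4::complex) ^ j else 0)"
        by (intro sum.cong) auto
      thus ?thesis using fin by simp
    qed
    moreover have "n \<in> S j \<longleftrightarrow> j = l"
      using ord[of j l n n] ord[of l j n n] that by (cases j l rule: linorder_cases) auto
    ultimately show ?thesis by (simp add: integral_unique)
  qed
  show ?thesis
  proof
    show "continuous_on {0..1} (\<Phi> J)"
      unfolding \<Phi>_def[abs_def] by (intro continuous_intros cont_f cont_E)
    show "norm (\<Phi> J x) \<le> 5" for x by (rule \<Phi>_le)
    fix l n assume l: "l \<le> J" and n: "n \<in> S l"
    define A where "A j = integral {0..1} (\<lambda>x. f j x * E J j x * fourier_char (- n) x)" for j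
    have A_ge: "(if j = l then (1/4) ^ l else 0) - (if j < l then 0 else 3/8 * (1/4) ^ j) \<le> Re (A j)" for j
    proof (cases "j < l")
      case True
      thus ?thesis using zero[OF True n] by (simp add: A_def)
    next
      case False
      have "A j = integral {0..1} (\<lambda>x. f j x * fourier_char (- n) x + f j x * (E J j x - 1) * fourier_char (- n) x)"
        unfolding A_def by (simp add: algebra_simps)
      also have "\<dots> = integral {0..1} (\<lambda>x. f j x * fourier_char (- n) x) + integral {0..1} (\<lambda>x. f j x * (E J j x - 1) * fourier_char (- n) x)"
        by (intro integral_add integrable_continuous_interval continuous_intros cont_f cont_E)
      finally have "Re (A j) = (if j = l then (1/4) ^ l else 0) + Re (integral {0..1} (\<lambda>x. f j x * (E J j x - 1) * fourier_char (- n) x))"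
        using main[OF n, of j] by (simp add: Re_power_real power_divide)
      moreover have "\<bar>Re (integral {0..1} (\<lambda>x. f j x * (E J j x - 1) * fourier_char (- n) x))\<bar> \<le> 3/8 * (1/4) ^ j"
        by (rule order_trans[OF abs_Re_le_cmod err])
      ultimately show ?thesis using False by auto
    qed
    have "integral {0..1} (\<lambda>x. \<Phi> J x * fourier_char (- n) x) = integral {0..1} (\<lambda>x. \<Sum>j\<le>J. f j x * E J j x * fourier_char (- n) x)"
      by (simp add: \<Phi>_def sum_distrib_right)
    also have "\<dots> = (\<Sum>j\<le>J. A j)"
      unfolding A_def by (intro integral_sum integrable_continuous_interval continuous_intros cont_f cont_E) auto
    finally have "Re (integral {0..1} (\<lambda>x. \<Phi> J x * fourier_char (- n) x)) = (\<Sum>j\<le>J. Re (A j))"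
      by simp
    also have "\<dots> \<ge> (\<Sum>j\<le>J. (if j = l then (1/4) ^ l else 0) - (if j < l then 0 else 3/8 * (1/4) ^ j))"
      by (intro sum_mono A_ge)
    \<comment> \<open>Only the blocks j >= l can do damage, and their total is at most 3/8 * 4/3 =
      1/2 of the main term 4^(-l).\<close>
    also have "(\<Sum>j\<le>J. (if j = l then (1/4::real) ^ l else 0) - (if j < l then 0 else 3/8 * (1/4) ^ j))
        = (1/4) ^ l - (\<Sum>j\<le>J. if j < l then 0 else 3/8 * (1/4) ^ j)"
      using l by (simp add: sum_subtractf)
    also have "(\<Sum>j\<le>J. if j < l then 0 else 3/8 * (1/4::real) ^ j) = (\<Sum>j\<in>{l..J}. 3/8 * (1/4) ^ j)"
      by (intro sum.mono_neutral_cong_right) auto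
    also have "\<dots> = 3/8 * (\<Sum>j\<in>{l..J}. (1/4) ^ j)" by (simp add: sum_distrib_left)
    finally show "(1/4) ^ l / 2 \<le> Re (integral {0..1} (\<lambda>x. \<Phi> J x * fourier_char (- n) x))"
      using sum_powers_quarter_le[of l J] by linarith
  qed
qed

section \<open>Ranks of frequencies and the Littlewood inequality\<close>

text \<open>Ranks count distinct values from the top, so repetitions only make them smaller.
  Removing an index of minimal value leaves the other ranks unchanged, and the removed one has rank
  at most \<open>card I\<close>.\<close>

lemma harm_le_sum_inverse_rank:
  fixes v :: "'a \<Rightarrow> int"
  assumes "finite I"
  shows "harm (card I) \<le> (\<Sum>i\<in>I. 1 / real (card {u \<in> v ` I. v i \<le> u}))"
  using assms
proof (induction "card I" arbitrary: I)
  case 0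
  thus ?case by (simp add: harm_def)
next
  case (Suc n)
  hence "I \<noteq> {}" "finite I" by auto
  then obtain i0 where i0: "i0 \<in> I" "\<And>i. i \<in> I \<Longrightarrow> v i0 \<le> v i"
    using arg_min_if_finite[of I v] by (metis linorder_not_less)
  define I' where "I' = I - {i0}"
  have I': "card I' = n" "finite I'" "I = insert i0 I'" "i0 \<notin> I'"
    using Suc i0 by (auto simp: I'_def)
  have eq: "{u \<in> v ` I. v i \<le> u} = {u \<in> v ` I'. v i \<le> u}" if "i \<in> I'" for i
    using that i0 I' by (auto intro: antisym)
  have fin: "finite {u \<in> v ` I. v i0 \<le> u}" using \<open>finite I\<close> by auto
  have "card {u \<in> v ` I. v i0 \<le> u} \<le> card (v ` I)"
    using \<open>finite I\<close> by (intro card_mono) auto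
  also have "\<dots> \<le> Suc n" using card_image_le[OF \<open>finite I\<close>, of v] Suc.hyps(2) by simp
  finally have "card {u \<in> v ` I. v i0 \<le> u} \<le> Suc n" .
  moreover have "card {u \<in> v ` I. v i0 \<le> u} > 0"
    using fin i0(1) by (auto simp: card_gt_0_iff)
  ultimately have last: "inverse (real (Suc n)) \<le> 1 / real (card {u \<in> v ` I. v i0 \<le> u})"
    by (simp add: inverse_eq_divide frac_le)
  have "harm (card I) = harm n + inverse (real (Suc n))"
    using Suc.hyps(2) by (simp flip: Suc.hyps(2) add: harm_Suc)
  also have "\<dots> \<le> (\<Sum>i\<in>I'. 1 / real (card {u \<in> v ` I'. v i \<le> u})) + 1 / real (card {u \<in> v ` I. v i0 \<le> u})"
    using Suc.hyps(1)[of I'] I' last by (intro add_mono) auto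
  also have "\<dots> = (\<Sum>i\<in>I. 1 / real (card {u \<in> v ` I. v i \<le> u}))"
    using I' eq by (simp add: add.commute)
  finally show ?case .
qed

text \<open>With 4^l = 3 q + 1, the condition 4^l <= 3 r < 4^(l+1) says q + 1 <= r <= 4 q + 1, which
  is exactly 4^l ranks. The blocks of ranks are thus consecutive of sizes 1, 4, 16, and so
  on.\<close>

lemma power4_mod3: "\<exists>q. (4::nat) ^ l = 3 * q + 1"
proof (induction l)
  case (Suc l)
  then obtain q where "(4::nat) ^ l = 3 * q + 1" by blast
  thus ?case by (intro exI[of _ "4 * q + 1"]) simp
qed simp

lemma quaternary_block:
  assumes "0 < (r::nat)"
  obtains l where "4 ^ l \<le> 3 * r" "3 * r < 4 ^ Suc l"
proof -
  define l where "l = (LEAST l. 3 * r < 4 ^ Suc l)"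
  have "3 * r < 4 ^ (3 * r)" by (rule power_gt_expt) simp
  also have "\<dots> < 4 ^ Suc (3 * r)" by simp
  finally have "3 * r < 4 ^ Suc l"
    unfolding l_def by (rule LeastI)
  moreover have "4 ^ l \<le> 3 * r"
  proof (cases l)
    case (Suc k)
    hence "\<not> 3 * r < 4 ^ Suc k"
      unfolding l_def by (intro not_less_Least) auto
    thus ?thesis by (simp add: Suc)
  qed (use assms in simp)
  ultimately show ?thesis by (rule that[rotated])
qed

text \<open>Testing against \<open>\<Phi>\<close>: at a frequency of rank r in block l its
  coefficient has real part at least 4^(-l) / 2 >= 1 / (6 r), as 4^l <= 3 r, while |\<Phi>| <= 5.
  Hence 30 = 5 * 6.\<close>

theorem littlewood_lower_bound:
  fixes v :: "'a \<Rightarrow> int"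
  assumes fin: "finite I"
  shows "harm (card I) \<le> 30 * integral {0..1} (\<lambda>x. norm (\<Sum>i\<in>I. fourier_char (v i) x))"
proof -
  define D where "D = v ` I"
  \<comment> \<open>The largest frequency has rank 1: the test function wants the larger frequencies
    in the earlier blocks.\<close>
  define rank where "rank n = card {u \<in> D. n \<le> u}" for n
  define S where "S l = {n \<in> D. 4 ^ l \<le> 3 * rank n \<and> 3 * rank n < 4 ^ Suc l}" for l
  have finD: "finite D" using fin by (simp add: D_def)
  have rank_mono: "rank n < rank m" if "m \<in> D" "n \<in> D" "m < n" for m n
  proof -
    have "m \<in> {u \<in> D. m \<le> u}" "m \<notin> {u \<in> D. n \<le> u}" "{u \<in> D. n \<le> u} \<subseteq> {u \<in> D. m \<le> u}"
      using that by auto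
    hence "{u \<in> D. n \<le> u} \<subset> {u \<in> D. m \<le> u}" by blast
    thus ?thesis unfolding rank_def using finD by (intro psubset_card_mono) auto
  qed
  have rank_pos: "0 < rank n" if "n \<in> D" for n
    using that finD by (auto simp: rank_def card_gt_0_iff)
  have S_ex: "\<exists>l. n \<in> S l" if n: "n \<in> D" for n
    using quaternary_block[OF rank_pos[OF n]] n unfolding S_def by blast
  have fin_S: "finite (S l)" for l using finD by (simp add: S_def)
  have inj: "inj_on rank D"
    by (rule inj_onI) (metis rank_mono less_irrefl linorder_cases)
  have card_S: "card (S l) \<le> 4 ^ l" for l
  proof -
    obtain q where q: "(4::nat) ^ l = 3 * q + 1" using power4_mod3 by blast
    have "card (S l) = card (rank ` S l)"
      by (intro card_image[symmetric] inj_on_subset[OF inj]) (auto simp: S_def)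
    also have "\<dots> \<le> card {q + 1..4 * q + 1}"
      by (intro card_mono) (auto simp: S_def q)
    finally show ?thesis using q by simp
  qed
  have ord: "n < m" if "l < l'" "m \<in> S l" "n \<in> S l'" for l l' m n
  proof (rule ccontr)
    assume "\<not> n < m"
    hence "rank n \<le> rank m"
      unfolding rank_def using finD by (intro card_mono) auto
    moreover have "(4::nat) ^ Suc l \<le> 4 ^ l'"
      using that(1) by (intro power_increasing) auto
    ultimately show False using that(2,3) unfolding S_def by auto
  qed
  \<comment> \<open>Any bound on the indices of nonempty blocks would do; this one follows from l <
    4^l <= 3 * rank.\<close>
  define J where "J = 3 * card D"
  have S_le_J: "l \<le> J" if "n \<in> S l" for n l
  proof -
    have "l < 4 ^ l" by (rule power_gt_expt) simp
    also have "4 ^ l \<le> 3 * rank n" using that by (simp add: S_def)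
    also have "rank n \<le> card D" unfolding rank_def using finD by (intro card_mono) auto
    finally show ?thesis by (simp add: J_def)
  qed
  obtain \<Phi> where \<Phi>: "continuous_on {0..1} \<Phi>" "\<And>x. norm (\<Phi> x) \<le> 5"
    "\<And>l n. l \<le> J \<Longrightarrow> n \<in> S l \<Longrightarrow> (1/4) ^ l / 2 \<le> Re (integral {0..1} (\<lambda>x. \<Phi> x * fourier_char (- n) x))"
  proof (rule littlewood_test_function[where S = S and J = J])
    show "n < m" if "l < l'" "m \<in> S l" "n \<in> S l'" for l l' m n by (rule ord[OF that])
  qed (rule fin_S card_S that)+
  define P where "P x = (\<Sum>i\<in>I. fourier_char (v i) x)" for x
  have cont_P: "continuous_on {0..1} P"
    unfolding P_def[abs_def] by (intro continuous_intros)
  have coeff: "1 / real (rank (v i)) / 6 \<le> Re (integral {0..1} (\<lambda>x. \<Phi> x * fourier_char (- v i) x))" if "i \<in> I" for i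
  proof -
    have "v i \<in> D" using that by (simp add: D_def)
    then obtain l where l: "v i \<in> S l" using S_ex by blast
    hence "(4::nat) ^ l \<le> 3 * rank (v i)" by (simp add: S_def)
    hence "real (4 ^ l) \<le> real (3 * rank (v i))" by (rule of_nat_mono)
    hence "1 / (3 * real (rank (v i))) \<le> 1 / 4 ^ l"
      by (intro frac_le) auto
    hence "1 / real (rank (v i)) / 6 \<le> (1/4) ^ l / 2" by (simp add: power_divide)
    thus ?thesis using \<Phi>(3)[OF S_le_J[OF l] l] by linarith
  qed
  have "harm (card I) \<le> (\<Sum>i\<in>I. 1 / real (rank (v i)))"
    unfolding rank_def D_def by (rule harm_le_sum_inverse_rank[OF fin])
  also have "\<dots> = 6 * (\<Sum>i\<in>I. 1 / real (rank (v i)) / 6)"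
    by (simp add: sum_distrib_left)
  also have "(\<Sum>i\<in>I. 1 / real (rank (v i)) / 6) \<le> (\<Sum>i\<in>I. Re (integral {0..1} (\<lambda>x. \<Phi> x * fourier_char (- v i) x)))"
    by (intro sum_mono coeff)
  also have "\<dots> = Re (\<Sum>i\<in>I. integral {0..1} (\<lambda>x. \<Phi> x * fourier_char (- v i) x))"
    by simp
  also have "(\<Sum>i\<in>I. integral {0..1} (\<lambda>x. \<Phi> x * fourier_char (- v i) x)) = integral {0..1} (\<lambda>x. \<Sum>i\<in>I. \<Phi> x * fourier_char (- v i) x)"
    by (intro integral_sum[symmetric] fin integrable_continuous_interval continuous_intros \<Phi>(1))
  also have "\<dots> = integral {0..1} (\<lambda>x. \<Phi> x * cnj (P x))"
    by (simp add: P_def cnj_fourier_char sum_distrib_left)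
  also have "Re \<dots> \<le> norm (integral {0..1} (\<lambda>x. \<Phi> x * cnj (P x)))" by (rule complex_Re_le_cmod)
  also have "\<dots> \<le> integral {0..1} (\<lambda>x. 5 * norm (P x))"
    by (intro integral_norm_bound_integral integrable_continuous_interval continuous_intros \<Phi>(1) cont_P)
       (auto simp: norm_mult intro!: mult_right_mono \<Phi>(2))
  also have "\<dots> = 5 * integral {0..1} (\<lambda>x. norm (P x))" by simp
  finally show ?thesis by (simp add: P_def)
qed

section \<open>The lower bound\<close>

lemma integral_abs_cosine_sum_ge:
  "harm (2 * N) \<le> 30 * integral {0..1} (\<lambda>x. \<bar>\<Sum>j=1..N. 2 * cos (2 * pi * real (a j) * x)\<bar>)"
proof -
  define P where "P x = (\<Sum>j=1..N. 2 * cos (2 * pi * real (a j) * x))" for x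
  \<comment> \<open>The index set is made of pairs, not of frequencies, so it has exactly 2 N
    elements even when some a_j coincide.\<close>
  define I where "I = {1..N} \<times> (UNIV :: bool set)"
  define v where "v = (\<lambda>(j, b). if b then int (a j) else - int (a j))"
  have "(\<Sum>i\<in>I. fourier_char (v i) x) = (\<Sum>j=1..N. \<Sum>b\<in>UNIV. fourier_char (v (j, b)) x)" for x
    unfolding I_def by (simp only: sum.cartesian_product) (simp add: case_prod_unfold)
  also have "\<dots> x = of_real (P x)" for x
    by (simp add: UNIV_bool v_def P_def fourier_char_def complex_eq_iff sum.distrib sum_negf sum_distrib_left[symmetric])
  finally have "norm (\<Sum>i\<in>I. fourier_char (v i) x) = \<bar>P x\<bar>" for x by simp
  moreover have "finite I" "card I = 2 * N" by (simp_all add: I_def card_cartesian_product)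
  ultimately show ?thesis
    using littlewood_lower_bound[of I v] by (simp add: P_def)
qed

lemma theta_block_min_upper_bound:
  assumes a: "\<And>j. j \<in> {1..N} \<Longrightarrow> 1 \<le> a j"
  shows "theta_block_min N a \<le> real N / 24 - harm (2 * N) * (6 / pi\<^sup>2 - 1/2) / 720"
proof -
  define P where "P x = (\<Sum>j=1..N. 2 * cos (2 * pi * real (a j) * x))" for x
  define V where "V x = (\<Sum>j=1..N. theta_B (real (a j) * x) - 1/24)" for x
  define \<mu> where "\<mu> = theta_block_min N a - real N / 24"
  define T where "T = integral {0..1} (\<lambda>x. \<bar>P x\<bar>)"
  have cont_P: "continuous_on A (\<lambda>x. P (c * x))" for A c
    unfolding P_def by (intro continuous_intros)
  have cont_V: "continuous_on A V" for A
    unfolding V_def[abs_def]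
    by (intro continuous_intros continuous_on_compose2[OF continuous_theta_B]) auto
  have \<mu>: "\<mu> \<le> V x" for x
    using theta_block_min_attained[of N a] by (auto simp: \<mu>_def V_def sum_subtractf)
  have P_per: "P (x + 1) = P x" for x
  proof -
    have "cos (2 * pi * real (a j) * (x + 1)) = cos (2 * pi * real (a j) * x)" for j
    proof -
      have "2 * pi * real (a j) * (x + 1) = 2 * pi * real (a j) * x + 2 * pi * of_int (int (a j))"
        by (simp add: algebra_simps)
      thus ?thesis
        by (simp only: cos_add sin_int_2pin cos_int_2pin mult_zero_right mult_1_right diff_zero)
    qed
    thus ?thesis by (simp add: P_def)
  qed
  have P_int: "(P has_integral 0) {0..1}"
  proof -
    have "((\<lambda>x. cos (2 * pi * real (a j) * x)) has_integral 0) {0..1}" if "j \<in> {1..N}" for j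
      using has_integral_Re[OF has_integral_fourier_char[of "int (a j)"]] a[OF that]
      by (simp add: fourier_char_def)
    hence "((\<lambda>x. \<Sum>j=1..N. 2 * cos (2 * pi * real (a j) * x)) has_integral (\<Sum>j=1..N. 2 * 0)) {0..1}"
      by (intro has_integral_sum has_integral_mult_right) auto
    thus ?thesis by (simp add: P_def[abs_def])
  qed
  have T_ge: "harm (2 * N) \<le> 30 * T"
    unfolding T_def P_def by (rule integral_abs_cosine_sum_ge)
  have approx: "\<exists>M\<ge>1. \<forall>x. \<bar>V x - 1 / (4 * pi\<^sup>2) * (\<Sum>k<M. P (real (Suc k) * x) / (real (Suc k))\<^sup>2)\<bar> \<le> real N * e"
    if "e > 0" for e
  proof -
    from uniform_limitD[OF theta_B_uniform_limit that]
    obtain M0 where M0: "\<And>n x. n \<ge> M0 \<Longrightarrow>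
        dist (1 / (2 * pi\<^sup>2) * (\<Sum>k<n. cos (2 * pi * real (Suc k) * x) / (real (Suc k))\<^sup>2)) (theta_B x - 1/24) < e"
      unfolding eventually_sequentially by blast
    define M where "M = max 1 M0"
    have "\<bar>V x - 1 / (4 * pi\<^sup>2) * (\<Sum>k<M. P (real (Suc k) * x) / (real (Suc k))\<^sup>2)\<bar> \<le> real N * e" for x
    proof -
      have "(\<Sum>k<M. P (real (Suc k) * x) / (real (Suc k))\<^sup>2)
          = (\<Sum>j=1..N. \<Sum>k<M. 2 * (cos (2 * pi * real (Suc k) * (real (a j) * x)) / (real (Suc k))\<^sup>2))"
        unfolding P_def sum_divide_distrib by (subst sum.swap) (simp add: mult_ac)
      hence "1 / (4 * pi\<^sup>2) * (\<Sum>k<M. P (real (Suc k) * x) / (real (Suc k))\<^sup>2)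
          = (\<Sum>j=1..N. 1 / (2 * pi\<^sup>2) * (\<Sum>k<M. cos (2 * pi * real (Suc k) * (real (a j) * x)) / (real (Suc k))\<^sup>2))"
        by (simp only: sum_distrib_left[symmetric])
      hence "\<bar>V x - 1 / (4 * pi\<^sup>2) * (\<Sum>k<M. P (real (Suc k) * x) / (real (Suc k))\<^sup>2)\<bar>
          = \<bar>\<Sum>j=1..N. (theta_B (real (a j) * x) - 1/24) -
              1 / (2 * pi\<^sup>2) * (\<Sum>k<M. cos (2 * pi * real (Suc k) * (real (a j) * x)) / (real (Suc k))\<^sup>2)\<bar>"
        by (simp only: V_def sum_subtractf)
      also have "\<dots> \<le> (\<Sum>j=1..N. \<bar>(theta_B (real (a j) * x) - 1/24) -
              1 / (2 * pi\<^sup>2) * (\<Sum>k<M. cos (2 * pi * real (Suc k) * (real (a j) * x)) / (real (Suc k))\<^sup>2)\<bar>)"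
        by (rule sum_abs)
      also have "\<dots> \<le> (\<Sum>j=1..N. e)"
        using M0[of M] by (intro sum_mono less_imp_le) (auto simp: dist_real_def M_def abs_minus_commute)
      finally show ?thesis by simp
    qed
    thus ?thesis by (intro exI[of _ M]) (auto simp: M_def)
  qed
  have main: "T * (2 - pi\<^sup>2 / 6) / (4 * pi\<^sup>2) \<le> - 2 * \<mu>"
    unfolding T_def
  proof (rule integral_abs_le_of_dilates[OF _ P_per P_int cont_V \<mu>])
    show "continuous_on UNIV P" using cont_P[of UNIV 1] by simp
    show "\<exists>M\<ge>1. \<forall>x. \<bar>V x - 1 / (4 * pi\<^sup>2) * (\<Sum>k<M. P (real (Suc k) * x) / (real (Suc k))\<^sup>2)\<bar> \<le> e"
      if "0 < e" for e
    proof -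
      \<comment> \<open>N + 1 in place of N keeps the quotient meaningful when N = 0.\<close>
      have "0 < e / (real N + 1)" "real N * (e / (real N + 1)) \<le> e"
        using that by (auto simp: field_simps)
      thus ?thesis using approx[of "e / (real N + 1)"] by (meson order_trans)
    qed
  qed
  define H :: real where "H = harm (2 * N)"
  define K :: real where "K = (2 - pi\<^sup>2 / 6) / (4 * pi\<^sup>2)"
  have "pi\<^sup>2 \<le> (3.1415927::real)\<^sup>2"
    using pi_bounds(2) by (rule power_mono) simp
  also have "\<dots> \<le> 12" by (simp add: power2_eq_square)
  finally have "0 \<le> K" by (simp add: K_def)
  moreover have "H / 30 \<le> T"
    using T_ge unfolding H_def by linarith
  ultimately have "H / 30 * K \<le> T * K" by (rule mult_right_mono[rotated])
  also have "T * K \<le> - 2 * \<mu>"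
    unfolding K_def times_divide_eq_right by (rule main)
  finally have "H * (K / 60) \<le> - \<mu>" by simp
  \<comment> \<open>The denominator 60 = 30 * 2 combines the Littlewood constant with the factor in
    -2 \<mu>; the 720 becomes 60 again when wt multiplies by 12.\<close>
  moreover have "K / 60 = (6 / pi\<^sup>2 - 1/2) / 720"
    by (simp add: K_def field_simps)
  ultimately have "H * ((6 / pi\<^sup>2 - 1/2) / 720) \<le> - \<mu>" by (simp only:)
  thus ?thesis unfolding \<mu>_def H_def times_divide_eq_right by linarith
qed

section \<open>Multisets of integers with bounded cosine sums\<close>

lemma exp_le_quadratic:
  fixes u :: real
  assumes "\<bar>u\<bar> \<le> 1"
  shows "exp u \<le> 1 + u + u\<^sup>2"
proof (cases "0 \<le> u")
  case True
  thus ?thesis using assms by (intro exp_bound) auto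
next
  case False
  \<comment> \<open>For negative u the comparison goes through exp u <= 1 / (1 - u), since the
    product here is 1 - u^3.\<close>
  have "1 \<le> (1 + u + u\<^sup>2) * (1 - u)"
  proof -
    have "(1 + u + u\<^sup>2) * (1 - u) = 1 + (- u) ^ 3"
      by (simp add: power2_eq_square power3_eq_cube algebra_simps)
    moreover have "0 \<le> (- u) ^ 3" using False by (intro zero_le_power) simp
    ultimately show ?thesis by linarith
  qed
  hence "1 / (1 - u) \<le> 1 + u + u\<^sup>2"
    using False by (simp add: pos_divide_le_eq)
  moreover have "exp u \<le> 1 / (1 - u)"
  proof -
    have "1 - u \<le> exp (- u)" using exp_ge_add_one_self[of "- u"] by simp
    hence "1 / exp (- u) \<le> 1 / (1 - u)" using False by (intro frac_le) auto
    thus ?thesis by (simp add: exp_minus inverse_eq_divide)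
  qed
  ultimately show ?thesis by linarith
qed

text \<open>Derandomised concentration: choosing the elements one at a time so that the sum over \<open>\<Theta>\<close>
  of exponential weights does not increase replaces a union bound over independent random choices.\<close>

lemma exists_choice_exp_weights:
  fixes y :: "'i \<Rightarrow> 'b \<Rightarrow> 'c \<Rightarrow> real"
  assumes F: "finite F" and \<Theta>: "finite \<Theta>"
    and C: "\<And>p. p \<in> F \<Longrightarrow> finite (C p)" "\<And>p. p \<in> F \<Longrightarrow> C p \<noteq> {}"
    and y: "\<And>p n \<theta>. p \<in> F \<Longrightarrow> n \<in> C p \<Longrightarrow> \<theta> \<in> \<Theta> \<Longrightarrow> \<bar>y p n \<theta>\<bar> \<le> 1"
    and \<mu>: "\<And>p \<theta>. p \<in> F \<Longrightarrow> \<theta> \<in> \<Theta> \<Longrightarrow> real (card (C p)) * \<mu> p \<theta> \<le> (\<Sum>n\<in>C p. y p n \<theta>)"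
    and L: "0 < L" "L \<le> 1"
  shows "\<exists>c. (\<forall>p\<in>F. c p \<in> C p) \<and>
    (\<Sum>\<theta>\<in>\<Theta>. exp (\<Sum>p\<in>F. L * (\<mu> p \<theta> - y p (c p) \<theta>) - L\<^sup>2)) \<le> real (card \<Theta>)"
  using F C y \<mu>
proof (induction F rule: finite_induct)
  case empty
  thus ?case by simp
next
  case (insert q F)
  have "\<exists>c. (\<forall>p\<in>F. c p \<in> C p) \<and>
    (\<Sum>\<theta>\<in>\<Theta>. exp (\<Sum>p\<in>F. L * (\<mu> p \<theta> - y p (c p) \<theta>) - L\<^sup>2)) \<le> real (card \<Theta>)"
    by (rule insert.IH) (use insert.prems in auto)
  then obtain c where c: "\<forall>p\<in>F. c p \<in> C p"
    "(\<Sum>\<theta>\<in>\<Theta>. exp (\<Sum>p\<in>F. L * (\<mu> p \<theta> - y p (c p) \<theta>) - L\<^sup>2)) \<le> real (card \<Theta>)"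
    by blast
  define w where "w \<theta> = exp (\<Sum>p\<in>F. L * (\<mu> p \<theta> - y p (c p) \<theta>) - L\<^sup>2)" for \<theta>
  define W where "W n = (\<Sum>\<theta>\<in>\<Theta>. w \<theta> * exp (L * (\<mu> q \<theta> - y q n \<theta>) - L\<^sup>2))" for n
  have fin: "finite (C q)" "C q \<noteq> {}" using insert.prems by auto
  \<comment> \<open>Averaged over the candidates, the new factor is at most 1: the subtracted L^2
    pays for the quadratic term in exp u <= 1 + u + u^2.\<close>
  have avg: "(\<Sum>n\<in>C q. exp (L * (\<mu> q \<theta> - y q n \<theta>) - L\<^sup>2)) \<le> real (card (C q))" if "\<theta> \<in> \<Theta>" for \<theta>
  proof -
    have step: "exp (- (L * y q n \<theta>)) \<le> 1 - L * y q n \<theta> + L\<^sup>2" if n: "n \<in> C q" for n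
    proof -
      have y1: "\<bar>y q n \<theta>\<bar> \<le> 1" using insert.prems(3) n \<open>\<theta> \<in> \<Theta>\<close> by simp
      hence "L * \<bar>y q n \<theta>\<bar> \<le> 1 * 1" using L by (intro mult_mono) auto
      hence "exp (- (L * y q n \<theta>)) \<le> 1 + - (L * y q n \<theta>) + (- (L * y q n \<theta>))\<^sup>2"
        using L by (intro exp_le_quadratic) (simp add: abs_mult)
      also have "(- (L * y q n \<theta>))\<^sup>2 \<le> L\<^sup>2"
        using y1 by (simp add: power_mult_distrib mult_left_le abs_square_le_1)
      finally show ?thesis by simp
    qed
    have "(\<Sum>n\<in>C q. exp (- (L * y q n \<theta>))) \<le> (\<Sum>n\<in>C q. 1 - L * y q n \<theta> + L\<^sup>2)"
      by (intro sum_mono step)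
    also have "\<dots> = card (C q) * (1 + L\<^sup>2) - L * (\<Sum>n\<in>C q. y q n \<theta>)"
      by (simp add: sum.distrib sum_subtractf sum_distrib_left algebra_simps)
    also have "\<dots> \<le> card (C q) * (1 + L\<^sup>2) - L * (real (card (C q)) * \<mu> q \<theta>)"
      using insert.prems(4) that L by (intro diff_left_mono mult_left_mono) auto
    also have "\<dots> = card (C q) * (1 + (L\<^sup>2 - L * \<mu> q \<theta>))" by (simp add: algebra_simps)
    also have "\<dots> \<le> card (C q) * exp (L\<^sup>2 - L * \<mu> q \<theta>)"
      by (intro mult_left_mono exp_ge_add_one_self) auto
    finally have le: "(\<Sum>n\<in>C q. exp (- (L * y q n \<theta>))) \<le> card (C q) * exp (L\<^sup>2 - L * \<mu> q \<theta>)" .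
    have "(\<Sum>n\<in>C q. exp (L * (\<mu> q \<theta> - y q n \<theta>) - L\<^sup>2)) = exp (L * \<mu> q \<theta> - L\<^sup>2) * (\<Sum>n\<in>C q. exp (- (L * y q n \<theta>)))"
    proof -
      have "exp (L * (\<mu> q \<theta> - y q n \<theta>) - L\<^sup>2) = exp (L * \<mu> q \<theta> - L\<^sup>2) * exp (- (L * y q n \<theta>))" for n
        by (simp add: algebra_simps flip: exp_add)
      thus ?thesis by (simp only: sum_distrib_left)
    qed
    also have "\<dots> \<le> exp (L * \<mu> q \<theta> - L\<^sup>2) * (card (C q) * exp (L\<^sup>2 - L * \<mu> q \<theta>))"
      by (intro mult_left_mono le) auto
    also have "\<dots> = card (C q) * exp ((L * \<mu> q \<theta> - L\<^sup>2) + (L\<^sup>2 - L * \<mu> q \<theta>))"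
      by (simp only: exp_add mult_ac)
    finally show ?thesis by simp
  qed
  have "(\<Sum>n\<in>C q. W n) = (\<Sum>\<theta>\<in>\<Theta>. w \<theta> * (\<Sum>n\<in>C q. exp (L * (\<mu> q \<theta> - y q n \<theta>) - L\<^sup>2)))"
    unfolding W_def by (subst sum.swap) (simp add: sum_distrib_left)
  also have "\<dots> \<le> (\<Sum>\<theta>\<in>\<Theta>. w \<theta> * real (card (C q)))"
    by (intro sum_mono mult_left_mono avg) (auto simp: w_def)
  also have "\<dots> = real (card (C q)) * (\<Sum>\<theta>\<in>\<Theta>. w \<theta>)"
    by (simp only: sum_distrib_right[symmetric] mult.commute)
  also have "\<dots> \<le> real (card (C q)) * real (card \<Theta>)"
    using c(2) unfolding w_def by (intro mult_left_mono) auto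
  finally have total: "(\<Sum>n\<in>C q. W n) \<le> real (card (C q)) * real (card \<Theta>)" .
  \<comment> \<open>Some candidate does no worse than the average; this is the method of conditional
    expectations.\<close>
  obtain n where n: "n \<in> C q" "W n \<le> real (card \<Theta>)"
  proof (rule ccontr)
    assume "\<not> thesis"
    hence "\<And>n. n \<in> C q \<Longrightarrow> real (card \<Theta>) < W n" using that by (meson not_le)
    hence "(\<Sum>n\<in>C q. real (card \<Theta>)) < (\<Sum>n\<in>C q. W n)"
      using fin by (intro sum_strict_mono) auto
    thus False using total by simp
  qed
  define c' where "c' = c(q := n)"
  have "(\<Sum>p\<in>insert q F. L * (\<mu> p \<theta> - y p (c' p) \<theta>) - L\<^sup>2)
      = (L * (\<mu> q \<theta> - y q n \<theta>) - L\<^sup>2) + (\<Sum>p\<in>F. L * (\<mu> p \<theta> - y p (c p) \<theta>) - L\<^sup>2)" for \<theta>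
  proof -
    have "(\<Sum>p\<in>F. L * (\<mu> p \<theta> - y p (c' p) \<theta>) - L\<^sup>2) = (\<Sum>p\<in>F. L * (\<mu> p \<theta> - y p (c p) \<theta>) - L\<^sup>2)"
      using insert.hyps by (intro sum.cong) (auto simp: c'_def)
    thus ?thesis using insert.hyps by (simp add: c'_def)
  qed
  hence "(\<Sum>\<theta>\<in>\<Theta>. exp (\<Sum>p\<in>insert q F. L * (\<mu> p \<theta> - y p (c' p) \<theta>) - L\<^sup>2)) = W n"
    by (simp only: exp_add W_def w_def mult.commute)
  moreover have "\<forall>p\<in>insert q F. c' p \<in> C p"
    using c(1) n(1) by (simp add: c'_def)
  ultimately show ?case using n(2) by (intro exI[of _ c']) simp
qed

text \<open>Each exponential weight is at most their sum, so a logarithm gives the estimate at every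
  angle. The two losses pull L in opposite directions; L is left free so that they can be
  balanced.\<close>

corollary exists_choice_sum_ge:
  fixes y :: "'i \<Rightarrow> 'b \<Rightarrow> 'c \<Rightarrow> real"
  assumes F: "finite F" and \<Theta>: "finite \<Theta>"
    and C: "\<And>p. p \<in> F \<Longrightarrow> finite (C p)" "\<And>p. p \<in> F \<Longrightarrow> C p \<noteq> {}"
    and y: "\<And>p n \<theta>. p \<in> F \<Longrightarrow> n \<in> C p \<Longrightarrow> \<theta> \<in> \<Theta> \<Longrightarrow> \<bar>y p n \<theta>\<bar> \<le> 1"
    and \<mu>: "\<And>p \<theta>. p \<in> F \<Longrightarrow> \<theta> \<in> \<Theta> \<Longrightarrow> real (card (C p)) * \<mu> p \<theta> \<le> (\<Sum>n\<in>C p. y p n \<theta>)"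
    and L: "0 < L" "L \<le> 1"
  obtains c where "\<And>p. p \<in> F \<Longrightarrow> c p \<in> C p"
    "\<And>\<theta>. \<theta> \<in> \<Theta> \<Longrightarrow> (\<Sum>p\<in>F. \<mu> p \<theta>) - real (card F) * L - ln (real (card \<Theta>)) / L \<le> (\<Sum>p\<in>F. y p (c p) \<theta>)"
proof -
  obtain c where c: "\<And>p. p \<in> F \<Longrightarrow> c p \<in> C p"
    "(\<Sum>\<theta>\<in>\<Theta>. exp (\<Sum>p\<in>F. L * (\<mu> p \<theta> - y p (c p) \<theta>) - L\<^sup>2)) \<le> real (card \<Theta>)"
  proof -
    have "\<exists>c. (\<forall>p\<in>F. c p \<in> C p) \<and>
      (\<Sum>\<theta>\<in>\<Theta>. exp (\<Sum>p\<in>F. L * (\<mu> p \<theta> - y p (c p) \<theta>) - L\<^sup>2)) \<le> real (card \<Theta>)"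
      by (rule exists_choice_exp_weights) (use assms in auto)
    with that show ?thesis by blast
  qed
  have "(\<Sum>p\<in>F. \<mu> p \<theta>) - real (card F) * L - ln (real (card \<Theta>)) / L \<le> (\<Sum>p\<in>F. y p (c p) \<theta>)" if \<theta>: "\<theta> \<in> \<Theta>" for \<theta>
  proof -
    define X where "X = (\<Sum>p\<in>F. L * (\<mu> p \<theta> - y p (c p) \<theta>) - L\<^sup>2)"
    have "exp X \<le> (\<Sum>\<theta>\<in>\<Theta>. exp (\<Sum>p\<in>F. L * (\<mu> p \<theta> - y p (c p) \<theta>) - L\<^sup>2))"
      unfolding X_def using \<theta> \<Theta> by (intro member_le_sum[where f = "\<lambda>\<theta>. exp (\<Sum>p\<in>F. L * (\<mu> p \<theta> - y p (c p) \<theta>) - L\<^sup>2)"]) auto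
    also note c(2)
    finally have "exp X \<le> real (card \<Theta>)" .
    moreover have "0 < card \<Theta>" using \<theta> \<Theta> by (auto simp: card_gt_0_iff)
    ultimately have "X \<le> ln (real (card \<Theta>))" by (simp add: ln_ge_iff)
    moreover have "X = L * ((\<Sum>p\<in>F. \<mu> p \<theta>) - (\<Sum>p\<in>F. y p (c p) \<theta>) - real (card F) * L)"
      by (simp add: X_def sum_subtractf sum.distrib sum_distrib_left power2_eq_square algebra_simps)
    ultimately have "(\<Sum>p\<in>F. \<mu> p \<theta>) - (\<Sum>p\<in>F. y p (c p) \<theta>) - real (card F) * L \<le> ln (real (card \<Theta>)) / L"
      using L(1) by (simp add: pos_le_divide_eq mult.commute)
    thus ?thesis by linarith
  qed
  with c(1) show ?thesis by (rule that)
qed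

section \<open>Closed forms and means over dyadic blocks\<close>

lemma sum_sin_half_integers:
  fixes \<theta> :: real
  assumes "A \<le> B"
  shows "2 * sin (\<theta> / 2) * (\<Sum>n\<in>{A..<B}. sin ((real n + 1/2) * \<theta>)) = cos (real A * \<theta>) - cos (real B * \<theta>)"
  using assms
proof (induction B rule: dec_induct)
  case (step B)
  have "2 * sin (\<theta> / 2) * sin ((real B + 1/2) * \<theta>)
      = cos ((real B + 1/2) * \<theta> - \<theta> / 2) - cos ((real B + 1/2) * \<theta> + \<theta> / 2)"
    by (simp add: cos_add cos_diff)
  moreover have "(real B + 1/2) * \<theta> - \<theta> / 2 = real B * \<theta>" "(real B + 1/2) * \<theta> + \<theta> / 2 = real (Suc B) * \<theta>"
    by (simp_all add: algebra_simps)
  ultimately have "2 * sin (\<theta> / 2) * sin ((real B + 1/2) * \<theta>) = cos (real B * \<theta>) - cos (real (Suc B) * \<theta>)"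
    by (simp only:)
  thus ?case using step by (simp add: distrib_left)
qed simp

lemma sum_cos_eq_sin:
  fixes \<theta> :: real
  shows "2 * sin (\<theta> / 2) * (\<Sum>k=1..n. cos (real k * \<theta>)) = sin ((real n + 1/2) * \<theta>) - sin (\<theta> / 2)"
proof (induction n)
  case (Suc n)
  have "2 * sin (\<theta> / 2) * cos (real (Suc n) * \<theta>)
      = sin (real (Suc n) * \<theta> + \<theta> / 2) - sin (real (Suc n) * \<theta> - \<theta> / 2)"
    by (simp add: sin_add sin_diff)
  moreover have "real (Suc n) * \<theta> + \<theta> / 2 = (real (Suc n) + 1/2) * \<theta>" "real (Suc n) * \<theta> - \<theta> / 2 = (real n + 1/2) * \<theta>"
    by (simp_all add: algebra_simps)
  ultimately have "2 * sin (\<theta> / 2) * cos (real (Suc n) * \<theta>)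
      = sin ((real (Suc n) + 1/2) * \<theta>) - sin ((real n + 1/2) * \<theta>)"
    by (simp only:)
  thus ?case using Suc by (simp add: distrib_left)
qed simp

text \<open>Summation by parts: since the weights halve at each step, all terms on the right except
  the one with g 0 are nonnegative as soon as g is.\<close>

lemma sum_dyadic_cos_differences:
  fixes g :: "nat \<Rightarrow> real"
  shows "(\<Sum>j<b. (g (Suc j) - g j) / 2 ^ j) = (\<Sum>j\<le>b. g j / 2 ^ j) + g b / 2 ^ b - 2 * g 0"
proof (induction b)
  case (Suc b)
  have "g (Suc b) / 2 ^ b = 2 * (g (Suc b) / 2 ^ Suc b)" by simp
  thus ?case using Suc unfolding sum.lessThan_Suc sum.atMost_Suc diff_divide_distrib by linarith
qed simp

text \<open>Summand j is the mean of sin ((n + 1/2) \<theta>) over the block starting at 2^j. After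
  summation by parts with g j = 1 - cos (2^j \<theta>) >= 0, the only loss is 2 * g 0 = 4 sin^2
  (\<theta>/2), and one well chosen scale supplies the gain.\<close>

lemma dyadic_mean_lower_bound:
  fixes \<theta> :: real
  assumes \<theta>: "0 < \<theta>" "\<theta> \<le> pi" and b: "pi \<le> 2 ^ b * \<theta>"
  shows "1 / pi - 2 * sin (\<theta> / 2)
    \<le> (\<Sum>j<b. (cos (2 ^ j * \<theta>) - cos (2 ^ Suc j * \<theta>)) / (2 * 2 ^ j * sin (\<theta> / 2)))"
proof -
  define s where "s = sin (\<theta> / 2)"
  have s: "0 < s" unfolding s_def using \<theta> by (intro sin_gt_zero) auto
  have s_le: "2 * s \<le> \<theta>" unfolding s_def using sin_x_le_x[of "\<theta> / 2"] \<theta> by simp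
  define g where "g j = 1 - cos (2 ^ j * \<theta>)" for j :: nat
  have g: "0 \<le> g j" for j by (simp add: g_def)
  \<comment> \<open>The first scale with 2^j \<theta> in [pi/2, pi]: there the cosine is not
    positive, so g j >= 1, while the weight 2^(-j) is still at least \<theta> / pi.\<close>
  define j where "j = (LEAST j. pi / 2 \<le> 2 ^ j * \<theta>)"
  have ex: "pi / 2 \<le> 2 ^ b * \<theta>" using b pi_gt_zero by linarith
  have j1: "pi / 2 \<le> 2 ^ j * \<theta>" unfolding j_def using ex by (rule LeastI)
  have jb: "j \<le> b" unfolding j_def using ex by (rule Least_le)
  have j2: "2 ^ j * \<theta> \<le> pi"
  proof (cases j)
    case (Suc k)
    hence "\<not> pi / 2 \<le> 2 ^ k * \<theta>" unfolding j_def by (intro not_less_Least) auto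
    thus ?thesis by (simp add: Suc)
  qed (use \<theta> in simp)
  have "cos (2 ^ j * \<theta>) \<le> cos (pi / 2)"
    using j1 j2 pi_gt_zero by (intro cos_monotone_0_pi_le) auto
  hence "1 \<le> g j" by (simp add: g_def)
  hence "1 / 2 ^ j \<le> g j / 2 ^ j" by (intro divide_right_mono) auto
  moreover have "\<theta> / pi \<le> 1 / 2 ^ j" using j2 by (simp add: field_simps)
  ultimately have "\<theta> / pi \<le> g j / 2 ^ j" by linarith
  also have "\<dots> \<le> (\<Sum>j\<le>b. g j / 2 ^ j)"
    using jb g by (intro member_le_sum[where f = "\<lambda>j. g j / 2 ^ j"]) auto
  also have "\<dots> \<le> (\<Sum>j\<le>b. g j / 2 ^ j) + g b / 2 ^ b" using g by simp
  finally have "\<theta> / pi - 2 * g 0 \<le> (\<Sum>j<b. (g (Suc j) - g j) / 2 ^ j)"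
    unfolding sum_dyadic_cos_differences by linarith
  moreover have "g 0 = 2 * s\<^sup>2"
    using cos_double_sin[of "\<theta> / 2"] by (simp add: g_def s_def)
  moreover have "2 * s / pi \<le> \<theta> / pi" using s_le by (intro divide_right_mono) auto
  ultimately have "2 * s * (1 / pi - 2 * s) \<le> (\<Sum>j<b. (g (Suc j) - g j) / 2 ^ j)"
    by (simp add: algebra_simps power2_eq_square)
  hence "1 / pi - 2 * s \<le> (\<Sum>j<b. (g (Suc j) - g j) / 2 ^ j) / (2 * s)"
    using s by (simp add: pos_le_divide_eq mult.commute)
  also have "\<dots> = (\<Sum>j<b. (cos (2 ^ j * \<theta>) - cos (2 ^ Suc j * \<theta>)) / (2 * 2 ^ j * s))"
    unfolding sum_divide_distrib g_def by (intro sum.cong) (auto simp: mult_ac)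
  finally show ?thesis by (simp add: s_def)
qed

text \<open>As n runs through a block so does its mirror image, hence the half sum over a pair has
  the block mean as its average, and l independent copies multiply the gain by l.\<close>

lemma dyadic_choice:
  fixes b l :: nat and L :: real and \<Theta> :: "real set"
  assumes L: "0 < L" "L \<le> 1" and fin: "finite \<Theta>"
    and \<Theta>: "\<And>\<theta>. \<theta> \<in> \<Theta> \<Longrightarrow> 0 < \<theta> \<and> \<theta> \<le> pi \<and> pi \<le> 2 ^ b * \<theta>"
  obtains c :: "nat \<times> nat \<Rightarrow> nat" where
    "\<And>p. p \<in> {..<b} \<times> {..<l} \<Longrightarrow> 2 ^ fst p \<le> c p \<and> c p < 2 ^ Suc (fst p)"
    "\<And>\<theta>. \<theta> \<in> \<Theta> \<Longrightarrow> 2 * (real l * (1 / pi - 2 * sin (\<theta> / 2)) - real (b * l) * L - ln (real (card \<Theta>)) / L)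
       \<le> (\<Sum>p\<in>{..<b} \<times> {..<l}. sin ((real (c p) + 1/2) * \<theta>) + sin ((real (3 * 2 ^ fst p - 1 - c p) + 1/2) * \<theta>))"
proof -
  define F where "F = {..<b} \<times> {..<l}"
  define C :: "nat \<times> nat \<Rightarrow> nat set" where "C p = {2 ^ fst p..<2 ^ Suc (fst p)}" for p
  \<comment> \<open>Halving keeps |y| <= 1, as the exponential weights require; the factor 2 in the
    conclusion undoes it.\<close>
  define y where "y p n \<theta> = (sin ((real n + 1/2) * \<theta>) + sin ((real (3 * 2 ^ fst p - 1 - n) + 1/2) * \<theta>)) / 2"
    for p :: "nat \<times> nat" and n :: nat and \<theta> :: real
  define \<mu> where "\<mu> p \<theta> = (cos (2 ^ fst p * \<theta>) - cos (2 ^ Suc (fst p) * \<theta>)) / (2 * 2 ^ fst p * sin (\<theta> / 2))"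
    for p :: "nat \<times> nat" and \<theta> :: real
  have sin_pos: "0 < sin (\<theta> / 2)" if "\<theta> \<in> \<Theta>" for \<theta>
    using \<Theta>[OF that] by (intro sin_gt_zero) auto
  obtain c where c: "\<And>p. p \<in> F \<Longrightarrow> c p \<in> C p"
    "\<And>\<theta>. \<theta> \<in> \<Theta> \<Longrightarrow> (\<Sum>p\<in>F. \<mu> p \<theta>) - real (card F) * L - ln (real (card \<Theta>)) / L \<le> (\<Sum>p\<in>F. y p (c p) \<theta>)"
  proof (rule exists_choice_sum_ge[where F = F and C = C and y = y and \<mu> = \<mu> and \<Theta> = \<Theta> and L = L])
    show "finite F" by (simp add: F_def)
    show "\<bar>y p n \<theta>\<bar> \<le> 1" for p n \<theta>
    proof -
      have "\<bar>sin u + sin v\<bar> \<le> 2" for u v :: real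
        using abs_triangle_ineq[of "sin u" "sin v"] abs_sin_le_one[of u] abs_sin_le_one[of v] by linarith
      thus ?thesis by (simp add: y_def)
    qed
    show "real (card (C p)) * \<mu> p \<theta> \<le> (\<Sum>n\<in>C p. y p n \<theta>)" if "\<theta> \<in> \<Theta>" for p \<theta>
    proof -
      define A :: nat where "A = 2 ^ fst p"
      have C_eq: "C p = {A..<2 * A}" by (simp add: C_def A_def)
      have refl: "(\<Sum>n\<in>{A..<2 * A}. sin ((real (3 * A - 1 - n) + 1/2) * \<theta>)) = (\<Sum>n\<in>{A..<2 * A}. sin ((real n + 1/2) * \<theta>))"
        by (rule sum.reindex_bij_witness[of _ "\<lambda>n. 3 * A - 1 - n" "\<lambda>n. 3 * A - 1 - n"]) auto
      have "(\<Sum>n\<in>C p. y p n \<theta>) = (\<Sum>n\<in>{A..<2 * A}. sin ((real n + 1/2) * \<theta>))"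
        unfolding C_eq y_def A_def[symmetric] sum_divide_distrib[symmetric] sum.distrib refl by simp
      also have "\<dots> = (cos (real A * \<theta>) - cos (real (2 * A) * \<theta>)) / (2 * sin (\<theta> / 2))"
        using sum_sin_half_integers[of A "2 * A" \<theta>] sin_pos[OF that]
        by (simp add: nonzero_eq_divide_eq mult.commute)
      also have "\<dots> = real (card (C p)) * \<mu> p \<theta>"
        by (simp add: C_eq \<mu>_def A_def mult.assoc)
      finally show ?thesis by simp
    qed
  qed (use L fin in \<open>auto simp: C_def\<close>)
  show ?thesis
  proof
    show "2 ^ fst p \<le> c p \<and> c p < 2 ^ Suc (fst p)" if "p \<in> {..<b} \<times> {..<l}" for p
      using c(1)[of p] that by (simp add: C_def F_def)
    fix \<theta> assume \<theta>: "\<theta> \<in> \<Theta>"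
    have "(\<Sum>p\<in>F. \<mu> p \<theta>) = real l * (\<Sum>j<b. (cos (2 ^ j * \<theta>) - cos (2 ^ Suc j * \<theta>)) / (2 * 2 ^ j * sin (\<theta> / 2)))"
      unfolding F_def sum.cartesian_product' \<mu>_def by (simp add: sum_distrib_left)
    also have "\<dots> \<ge> real l * (1 / pi - 2 * sin (\<theta> / 2))"
      using \<Theta>[OF \<theta>] by (intro mult_left_mono dyadic_mean_lower_bound) auto
    finally have le: "real l * (1 / pi - 2 * sin (\<theta> / 2)) - real (b * l) * L - ln (real (card \<Theta>)) / L \<le> (\<Sum>p\<in>F. y p (c p) \<theta>)"
      using c(2)[OF \<theta>] by (simp add: F_def card_cartesian_product)
    have "(\<Sum>p\<in>F. y p (c p) \<theta>) = (\<Sum>p\<in>F. sin ((real (c p) + 1/2) * \<theta>) + sin ((real (3 * 2 ^ fst p - 1 - c p) + 1/2) * \<theta>)) / 2"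
      unfolding y_def sum_divide_distrib[symmetric] ..
    moreover have "u \<le> v / 2 \<Longrightarrow> 2 * u \<le> v" for u v :: real by simp
    ultimately show "2 * (real l * (1 / pi - 2 * sin (\<theta> / 2)) - real (b * l) * L - ln (real (card \<Theta>)) / L)
       \<le> (\<Sum>p\<in>{..<b} \<times> {..<l}. sin ((real (c p) + 1/2) * \<theta>) + sin ((real (3 * 2 ^ fst p - 1 - c p) + 1/2) * \<theta>))"
      using le unfolding F_def by (simp only:)
  qed
qed

section \<open>From grid angles to all angles, and from sines to cosines\<close>

lemma sin_lipschitz: "\<bar>sin x - sin y\<bar> \<le> \<bar>x - y\<bar>" for x y :: real
proof -
  have "norm (sin x - sin y) \<le> 1 * norm (x - y)"
    by (rule field_differentiable_bound[where S = UNIV and f' = cos]) (auto intro: DERIV_sin)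
  thus ?thesis by simp
qed

text \<open>For \<theta> <= pi / M all arguments stay in [0, pi] and every sine is nonnegative. Any
  other angle is moved to a grid point, and the reserve \<open>A\<close> absorbs the Lipschitz error
  of the sine sum and of B * sin (\<theta>/2).\<close>

lemma sum_sin_ge_from_grid:
  fixes n :: "'k \<Rightarrow> nat" and M G :: nat and A B :: real
  defines "\<Theta> \<equiv> {\<theta>. \<exists>k\<in>{1..G}. \<theta> = pi * real k / real G \<and> pi \<le> real M * \<theta>}"
  assumes G: "0 < G" and B: "0 \<le> B" and nM: "\<And>\<kappa>. \<kappa> \<in> K \<Longrightarrow> n \<kappa> < M"
    and grid: "\<And>\<theta>. \<theta> \<in> \<Theta> \<Longrightarrow> A - B * sin (\<theta> / 2) \<le> (\<Sum>\<kappa>\<in>K. sin ((real (n \<kappa>) + 1/2) * \<theta>))"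
    and A: "((\<Sum>\<kappa>\<in>K. real (n \<kappa>) + 1/2) + B / 2) * (pi / real G) \<le> A"
    and \<theta>: "0 < \<theta>" "\<theta> \<le> pi"
  shows "- B * sin (\<theta> / 2) \<le> (\<Sum>\<kappa>\<in>K. sin ((real (n \<kappa>) + 1/2) * \<theta>))"
proof (cases "real M * \<theta> \<le> pi")
  case True
  have "0 \<le> sin ((real (n \<kappa>) + 1/2) * \<theta>)" if "\<kappa> \<in> K" for \<kappa>
  proof (rule sin_ge_zero)
    have "(real (n \<kappa>) + 1/2) * \<theta> \<le> real M * \<theta>"
      using nM[OF that] \<theta> by (intro mult_right_mono) auto
    thus "(real (n \<kappa>) + 1/2) * \<theta> \<le> pi" using True by linarith
  qed (use \<theta> in auto)
  hence "0 \<le> (\<Sum>\<kappa>\<in>K. sin ((real (n \<kappa>) + 1/2) * \<theta>))" by (rule sum_nonneg)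
  moreover have "0 \<le> sin (\<theta> / 2)" using \<theta> by (intro sin_ge_zero) auto
  hence "0 \<le> B * sin (\<theta> / 2)" using B by simp
  ultimately show ?thesis by linarith
next
  case False
  define \<delta> where "\<delta> = pi / real G"
  have \<delta>: "\<delta> > 0" using G by (simp add: \<delta>_def)
  \<comment> \<open>Rounding up, not to the nearest point, keeps pi <= M * \<theta>', so the grid
    hypothesis applies.\<close>
  define k where "k = nat \<lceil>\<theta> / \<delta>\<rceil>"
  define \<theta>' where "\<theta>' = pi * real k / real G"
  have \<theta>'_eq: "\<theta>' = real k * \<delta>" by (simp add: \<theta>'_def \<delta>_def)
  have pos: "0 < \<theta> / \<delta>" using \<theta> \<delta> by simp
  have k_real: "real k = of_int \<lceil>\<theta> / \<delta>\<rceil>" using pos by (simp add: k_def)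
  have k1: "\<theta> / \<delta> \<le> real k" "real k < \<theta> / \<delta> + 1" unfolding k_real by linarith+
  have "\<theta> / \<delta> \<le> real G" using \<theta> G by (simp add: \<delta>_def field_simps)
  hence kG: "k \<in> {1..G}"
    using pos k1 by auto
  have \<theta>': "\<theta> \<le> \<theta>'" "\<theta>' \<le> \<theta> + \<delta>"
    using k1 \<delta> by (auto simp: \<theta>'_eq field_simps)
  have "pi \<le> real M * \<theta>'"
    using False mult_left_mono[OF \<theta>'(1), of "real M"] by simp
  hence mem: "\<theta>' \<in> \<Theta>" using kG by (auto simp: \<Theta>_def \<theta>'_def)
  have 1: "sin ((real (n \<kappa>) + 1/2) * \<theta>') - (real (n \<kappa>) + 1/2) * \<delta> \<le> sin ((real (n \<kappa>) + 1/2) * \<theta>)" for \<kappa>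
  proof -
    have "\<bar>sin ((real (n \<kappa>) + 1/2) * \<theta>') - sin ((real (n \<kappa>) + 1/2) * \<theta>)\<bar> \<le> \<bar>(real (n \<kappa>) + 1/2) * \<theta>' - (real (n \<kappa>) + 1/2) * \<theta>\<bar>"
      by (rule sin_lipschitz)
    also have "\<dots> = (real (n \<kappa>) + 1/2) * (\<theta>' - \<theta>)"
      using \<theta>'(1) by (simp add: abs_mult flip: right_diff_distrib)
    also have "\<dots> \<le> (real (n \<kappa>) + 1/2) * \<delta>"
      using \<theta>'(2) by (intro mult_left_mono) auto
    finally show ?thesis by linarith
  qed
  have "\<bar>sin (\<theta>' / 2) - sin (\<theta> / 2)\<bar> \<le> \<delta> / 2"
    using sin_lipschitz[of "\<theta>' / 2" "\<theta> / 2"] \<theta>' by simp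
  hence "sin (\<theta>' / 2) \<le> sin (\<theta> / 2) + \<delta> / 2" by linarith
  hence "B * sin (\<theta>' / 2) \<le> B * (sin (\<theta> / 2) + \<delta> / 2)"
    using B by (rule mult_left_mono)
  hence 2: "B * sin (\<theta>' / 2) \<le> B * sin (\<theta> / 2) + B / 2 * \<delta>" by (simp add: algebra_simps)
  have "A - B * sin (\<theta>' / 2) - (\<Sum>\<kappa>\<in>K. real (n \<kappa>) + 1/2) * \<delta>
      \<le> (\<Sum>\<kappa>\<in>K. sin ((real (n \<kappa>) + 1/2) * \<theta>') - (real (n \<kappa>) + 1/2) * \<delta>)"
    unfolding sum_subtractf sum_distrib_right using grid[OF mem] by simp
  also have "\<dots> \<le> (\<Sum>\<kappa>\<in>K. sin ((real (n \<kappa>) + 1/2) * \<theta>))" by (intro sum_mono 1)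
  finally show ?thesis using 2 A unfolding \<delta>_def[symmetric] distrib_right by linarith
qed

text \<open>Division by 2 sin (\<theta>/2) turns each sine into an interval's cosine sum plus 1/2,
  whence \<open>card K\<close>. The angle 0, where one cannot divide, is trivial; evenness and
  periodicity cover the rest.\<close>

lemma sum_cos_ge_from_sin:
  fixes n :: "'k \<Rightarrow> nat" and B :: real
  assumes fin: "finite K" and B: "0 \<le> B"
    and sin_ge: "\<And>\<theta>. 0 < \<theta> \<Longrightarrow> \<theta> \<le> pi \<Longrightarrow> - B * sin (\<theta> / 2) \<le> (\<Sum>\<kappa>\<in>K. sin ((real (n \<kappa>) + 1/2) * \<theta>))"
  shows "- (B + real (card K)) / 2 \<le> (\<Sum>\<kappa>\<in>K. \<Sum>k=1..n \<kappa>. cos (real k * x))"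
proof -
  define f where "f x = (\<Sum>\<kappa>\<in>K. \<Sum>k=1..n \<kappa>. cos (real k * x))" for x
  have pos: "- (B + real (card K)) / 2 \<le> f \<theta>" if "0 < \<theta>" "\<theta> \<le> pi" for \<theta>
  proof -
    have s: "0 < sin (\<theta> / 2)" using that by (intro sin_gt_zero) auto
    have "2 * sin (\<theta> / 2) * f \<theta> = (\<Sum>\<kappa>\<in>K. sin ((real (n \<kappa>) + 1/2) * \<theta>) - sin (\<theta> / 2))"
      unfolding f_def sum_distrib_left[of _ _ K] sum_cos_eq_sin ..
    also have "\<dots> = (\<Sum>\<kappa>\<in>K. sin ((real (n \<kappa>) + 1/2) * \<theta>)) - card K * sin (\<theta> / 2)"
      by (simp add: sum_subtractf)
    also have "\<dots> \<ge> - B * sin (\<theta> / 2) - card K * sin (\<theta> / 2)"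
      using sin_ge[OF that] by simp
    finally have "sin (\<theta> / 2) * (- (B + real (card K)) / 2) \<le> sin (\<theta> / 2) * f \<theta>"
      by (simp add: algebra_simps)
    thus ?thesis using s by (simp only: mult_le_cancel_left_pos)
  qed
  have zero: "- (B + real (card K)) / 2 \<le> f 0"
  proof -
    have "0 \<le> f 0" by (simp add: f_def sum_nonneg)
    thus ?thesis using B by simp
  qed
  have even: "f (- x) = f x" for x by (simp add: f_def)
  have per: "f (x + 2 * pi * of_int m) = f x" for x m
  proof -
    have "cos (real k * (x + 2 * pi * of_int m)) = cos (real k * x)" for k
    proof -
      have "real k * (x + 2 * pi * of_int m) = real k * x + 2 * pi * of_int (int k * m)"
        by (simp add: algebra_simps)
      thus ?thesis
        by (simp only: cos_add sin_int_2pin cos_int_2pin mult_zero_right mult_1_right diff_zero)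
    qed
    thus ?thesis by (simp add: f_def)
  qed
  \<comment> \<open>Subtracting the nearest multiple of 2 pi brings the argument into
    [-pi, pi].\<close>
  define y where "y = x - 2 * pi * of_int (round (x / (2 * pi)))"
  have "\<bar>of_int (round (x / (2 * pi))) - x / (2 * pi)\<bar> \<le> 1/2" by (rule of_int_round_abs_le)
  hence "2 * pi * \<bar>of_int (round (x / (2 * pi))) - x / (2 * pi)\<bar> \<le> 2 * pi * (1/2)"
    by (intro mult_left_mono) auto
  also have "2 * pi * \<bar>of_int (round (x / (2 * pi))) - x / (2 * pi)\<bar> = \<bar>y\<bar>"
  proof -
    have "2 * pi * (of_int (round (x / (2 * pi))) - x / (2 * pi)) = - y"
      by (simp add: y_def algebra_simps)
    hence "\<bar>2 * pi * (of_int (round (x / (2 * pi))) - x / (2 * pi))\<bar> = \<bar>y\<bar>" by simp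
    thus ?thesis by (simp add: abs_mult)
  qed
  finally have y: "\<bar>y\<bar> \<le> pi" by simp
  have "f x = f y"
    using per[of y "round (x / (2 * pi))"] by (simp add: y_def)
  moreover have "- (B + real (card K)) / 2 \<le> f y"
    using pos[of y] pos[of "- y"] zero even[of y] y
    by (cases y "0::real" rule: linorder_cases) auto
  ultimately show ?thesis by (simp add: f_def)
qed

text \<open>A disjoint union of the intervals {1..n \<kappa>} keeps multiplicities; reading off
  second components along any enumeration of it gives the sequence a_j.\<close>

lemma exists_enumeration_of_jumps:
  fixes n :: "'k \<Rightarrow> nat" and f :: "nat \<Rightarrow> 'c \<Rightarrow> real"
  assumes fin: "finite K"
  obtains a :: "nat \<Rightarrow> nat" where "\<And>j. j \<in> {1..\<Sum>\<kappa>\<in>K. n \<kappa>} \<Longrightarrow> 1 \<le> a j"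
    "\<And>x. (\<Sum>j=1..(\<Sum>\<kappa>\<in>K. n \<kappa>). f (a j) x) = (\<Sum>\<kappa>\<in>K. \<Sum>k=1..n \<kappa>. f k x)"
proof -
  define S where "S = (SIGMA \<kappa>:K. {1..n \<kappa>})"
  have "finite S" using fin by (auto simp: S_def)
  moreover have "card S = (\<Sum>\<kappa>\<in>K. n \<kappa>)" using fin by (simp add: S_def)
  ultimately obtain h where h: "bij_betw h {1..\<Sum>\<kappa>\<in>K. n \<kappa>} S"
    using ex_bij_betw_nat_finite_1[of S] by auto
  show ?thesis
  proof
    show "1 \<le> snd (h j)" if "j \<in> {1..\<Sum>\<kappa>\<in>K. n \<kappa>}" for j
      using bij_betwE[OF h] that by (fastforce simp: S_def)
    fix x
    have "(\<Sum>j=1..(\<Sum>\<kappa>\<in>K. n \<kappa>). f (snd (h j)) x) = (\<Sum>s\<in>S. f (snd s) x)"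
      by (rule sum.reindex_bij_betw[OF h])
    also have "\<dots> = (\<Sum>\<kappa>\<in>K. \<Sum>k=1..n \<kappa>. f k x)"
      unfolding S_def using fin by (subst sum.Sigma) (auto simp: case_prod_unfold)
    finally show "(\<Sum>j=1..(\<Sum>\<kappa>\<in>K. n \<kappa>). f (snd (h j)) x) = (\<Sum>\<kappa>\<in>K. \<Sum>k=1..n \<kappa>. f k x)" .
  qed
qed

text \<open>The family \<open>n\<close> below consists of \<open>l\<close> pairs for each of the \<open>b\<close> dyadic blocks and of \<open>q + 1\<close> further
  values that bring the total to exactly \<open>N\<close>; the latter are too few to matter.\<close>

lemma exists_cosine_multiset:
  fixes N :: nat
  defines "t \<equiv> ln (real N)"
  assumes big: "90000 * (1 + t ^ 3) < real N"
  obtains a :: "nat \<Rightarrow> nat" where "\<And>j. j \<in> {1..N} \<Longrightarrow> 1 \<le> a j"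
    "\<And>x. - (45000 * (1 + t ^ 3)) \<le> (\<Sum>j=1..N. cos (real (a j) * x))"
proof -
  have N0: "0 < N" using big by (cases "N = 0") (auto simp: t_def)
  have "0 \<le> t" using N0 by (simp add: t_def)
  have big': "90000 + 90000 * t ^ 3 < real N" using big by (simp only: distrib_left mult_1_right)
  have N_big: "90000 < real N" using big' zero_le_power[OF \<open>0 \<le> t\<close>, of 3] by linarith
  have "exp 11 = exp (1::real) ^ 11" by (simp flip: exp_of_nat_mult)
  also have "\<dots> \<le> (272 / 100) ^ 11" using e_less_272 by (intro power_mono) auto
  also have "\<dots> \<le> real N" using N_big by (simp add: power_divide)
  finally have t11: "11 \<le> t" unfolding t_def using N0 by (simp add: ln_ge_iff)
  have t2: "121 \<le> t\<^sup>2" using power_mono[OF t11, of 2] by simp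
  have t3: "11 * t\<^sup>2 \<le> t ^ 3" "t ^ 3 = t * t\<^sup>2"
    using t11 mult_right_mono[OF t11, of "t\<^sup>2"] by (simp_all add: power3_eq_cube power2_eq_square)

  \<comment> \<open>The number of blocks is chosen so that l, about N / (3 * 2^b), lands between 720
    t^2 and 1460 t^2; note 4380 = 3 * 1460.\<close>
  define b where "b = (LEAST b. real N < 4380 * t\<^sup>2 * 2 ^ b)"
  obtain b0 :: nat where b0: "real N / (4380 * t\<^sup>2) < 2 ^ b0"
    using real_arch_pow[of 2 "real N / (4380 * t\<^sup>2)"] by auto
  have "0 < 4380 * t\<^sup>2" using t2 by linarith
  from pos_divide_less_eq[OF this, THEN iffD1, OF b0]
  have "real N < 4380 * t\<^sup>2 * 2 ^ b0" by (subst mult.commute)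
  hence N_less: "real N < 4380 * t\<^sup>2 * 2 ^ b" unfolding b_def by (rule LeastI)
  have "4380 * t\<^sup>2 \<le> real N" using big' t3(1) t2 by linarith
  hence b_nz: "b \<noteq> 0" using N_less by (intro notI) simp
  obtain b' where b': "b = Suc b'" using b_nz by (cases b) auto
  have "\<not> real N < 4380 * t\<^sup>2 * 2 ^ b'" using b' unfolding b_def by (intro not_less_Least) auto
  hence N_ge: "2190 * t\<^sup>2 * 2 ^ b \<le> real N" by (simp add: b')
  define M :: nat where "M = 2 ^ b"
  have M_real: "real M = 2 ^ b" by (simp add: M_def)
  \<comment> \<open>This uses the size of N: 90000 t^3 < N < 4380 t^2 M gives M > 20 t, so that the
    b missing units per layer stay small against M.\<close>
  have Mt: "20 * t < real M"
  proof -
    have "90000 * t * t\<^sup>2 < 4380 * real M * t\<^sup>2"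
      using big' N_less t3(2) by (simp add: M_real mult_ac)
    hence "90000 * t < 4380 * real M" using t2 by (simp add: mult_less_cancel_right)
    thus ?thesis using t11 by linarith
  qed
  hence M220: "220 < real M" using t11 by linarith
  \<comment> \<open>One pair from every block uses 3 (2^b - 1) - b elements, slightly fewer than 3
    M, so l such layers fit into N.\<close>
  define l where "l = N div (3 * M)"
  have lN: "3 * l * M \<le> N"
    unfolding l_def using times_div_less_eq_dividend[of "3 * M" N] by (simp add: mult_ac)
  have Nl: "N < 3 * l * M + 3 * M"
    using dividend_less_div_times[of "3 * M" N] M220 unfolding l_def by (simp add: mult_ac)
  have lN': "3 * real l * real M \<le> real N"
    using of_nat_mono[OF lN, where 'a = real] by (simp only: of_nat_mult of_nat_numeral)
  have Nl': "real N < 3 * real l * real M + 3 * real M"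
    using of_nat_less_iff[where 'a = real, THEN iffD2, OF Nl] by (simp only: of_nat_add of_nat_mult of_nat_numeral)
  have l_ge: "720 * t\<^sup>2 \<le> real l"
  proof -
    have "730 * t\<^sup>2 * (3 * real M) < (real l + 1) * (3 * real M)"
      using N_ge Nl' by (simp add: M_real algebra_simps)
    hence "730 * t\<^sup>2 < real l + 1" using M220 by (simp add: mult_less_cancel_right)
    thus ?thesis using t2 by linarith
  qed
  have l_le: "real l \<le> 1460 * t\<^sup>2"
  proof -
    have "real l * (3 * real M) \<le> 1460 * t\<^sup>2 * (3 * real M)"
    proof -
      have "1460 * t\<^sup>2 * (3 * real M) = 4380 * t\<^sup>2 * 2 ^ b" by (simp add: M_real)
      moreover have "real l * (3 * real M) = 3 * real l * real M" by simp
      ultimately show ?thesis using N_less lN' by linarith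
    qed
    thus ?thesis using M220 by (simp add: mult_le_cancel_right)
  qed
  have l_big: "87120 \<le> real l" using l_ge t2 by linarith
  have b_le: "real b \<le> 3/2 * t"
  proof -
    have "1 * real M \<le> (3 * real l) * real M" using l_big by (intro mult_right_mono) auto
    hence "real M \<le> real N" using lN' by linarith
    hence "ln (2 ^ b) \<le> t" unfolding M_real unfolding t_def by (intro ln_mono) auto
    hence "real b * ln 2 \<le> t" by (simp add: ln_realpow)
    moreover have "real b * (2/3) \<le> real b * ln 2" using ln2_ge_two_thirds by (intro mult_left_mono) auto
    ultimately show ?thesis by linarith
  qed
  \<comment> \<open>This makes \<open>card F * L\<close> equal to l / 20. The other loss is 20 b ln
    G <= 36 t^2, which is at most l / 20 because l >= 720 t^2.\<close>
  define L where "L = 1 / (20 * real b)"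
  have L: "0 < L" "L \<le> 1" using b_nz by (auto simp: L_def)
  \<comment> \<open>The sum of the Lipschitz constants will be at most 2 N, so a grid of 8 N points
    costs at most pi / 4 < 2 <= A.\<close>
  define G where "G = 8 * N"
  define \<Theta> where "\<Theta> = {\<theta>. \<exists>k\<in>{1..G}. \<theta> = pi * real k / real G \<and> pi \<le> real M * \<theta>}"
  have \<Theta>_sub: "\<Theta> \<subseteq> (\<lambda>k. pi * real k / real G) ` {1..G}" by (auto simp: \<Theta>_def)
  hence fin\<Theta>: "finite \<Theta>" by (rule finite_subset) auto
  have card\<Theta>: "card \<Theta> \<le> G"
    using card_mono[OF _ \<Theta>_sub] card_image_le[of "{1..G}" "\<lambda>k. pi * real k / real G"] by simp
  have \<Theta>: "0 < \<theta> \<and> \<theta> \<le> pi \<and> pi \<le> 2 ^ b * \<theta>" if "\<theta> \<in> \<Theta>" for \<theta>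
  proof -
    obtain k where k: "k \<in> {1..G}" "\<theta> = pi * real k / real G" "pi \<le> real M * \<theta>"
      using \<open>\<theta> \<in> \<Theta>\<close> unfolding \<Theta>_def by blast
    define u where "u = real k / real G"
    have "\<theta> = pi * u" "u \<le> 1" "0 < u"
      using k by (auto simp: u_def)
    thus ?thesis using k(3) by (simp add: M_real mult_left_le)
  qed
  define F where "F = {..<b} \<times> {..<l}"
  have finF: "finite F" "card F = b * l" by (auto simp: F_def card_cartesian_product)
  obtain c :: "nat \<times> nat \<Rightarrow> nat" where c0: "\<And>p. p \<in> {..<b} \<times> {..<l} \<Longrightarrow> 2 ^ fst p \<le> c p \<and> c p < 2 ^ Suc (fst p)"
    "\<And>\<theta>. \<theta> \<in> \<Theta> \<Longrightarrow> 2 * (real l * (1 / pi - 2 * sin (\<theta> / 2)) - real (b * l) * L - ln (real (card \<Theta>)) / L)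
       \<le> (\<Sum>p\<in>{..<b} \<times> {..<l}. sin ((real (c p) + 1/2) * \<theta>) + sin ((real (3 * 2 ^ fst p - 1 - c p) + 1/2) * \<theta>))"
    by (rule dyadic_choice[where b = b and l = l, OF L fin\<Theta> \<Theta>]) (assumption, rule that)
  note c = c0[folded F_def]
  \<comment> \<open>Known before \<open>c\<close> is: the two members of a pair always add up to 3 *
    2^j - 1.\<close>
  define T where "T = (\<Sum>p\<in>F. 3 * 2 ^ fst p - 1 :: nat)"
  have T_real: "real T = real l * (3 * (real M - 1) - real b)"
  proof -
    have "real T = (\<Sum>p\<in>F. 3 * 2 ^ fst p - 1)"
      unfolding T_def of_nat_sum by (intro sum.cong) (auto simp: of_nat_diff)
    also have "\<dots> = (\<Sum>j<b. real l * (3 * 2 ^ j - 1))"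
      unfolding F_def sum.cartesian_product' by simp
    also have "\<dots> = real l * (3 * (\<Sum>j<b. 2 ^ j) - real b)"
      by (simp only: sum_distrib_left[symmetric] sum_subtractf) simp
    also have "(\<Sum>j<b. (2::real) ^ j) = real M - 1"
      by (simp add: sum_gp_strict M_real)
    finally show ?thesis .
  qed
  have "real T \<le> 3 * real l * real M"
    unfolding T_real by (simp add: algebra_simps)
  hence T_le: "T \<le> N" using lN' by linarith
  define R where "R = N - T"
  \<comment> \<open>The remainder is cut into values below M, as the grid lemma demands. The last
    value s may be 0, which is an empty interval.\<close>
  define q where "q = R div (M - 1)"
  define s where "s = R mod (M - 1)"
  have R_eq: "R = q * (M - 1) + s" unfolding q_def s_def by (rule div_mult_mod_eq[symmetric])
  have s_less: "s < M - 1" unfolding s_def using M220 by simp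
  have R_real: "real R < 3 * real M + real l * (3 + real b)"
    using Nl' T_le unfolding R_def by (simp add: of_nat_diff T_real algebra_simps)
  \<comment> \<open>R is at most 3 M from rounding in l plus l (3 + b) from the shortfall of the
    layers. As b <= 3 t / 2 and M > 20 t, the latter is below l (M - 1) / 10.\<close>
  have q_le: "real q \<le> 4 + real l / 10"
  proof -
    have "real q * (real M - 1) \<le> real R"
      using R_eq M220 by (simp add: of_nat_diff)
    also have "real l * (3 + real b) \<le> real l * (9/5 * t)"
      using b_le t11 by (intro mult_left_mono) auto
    hence "real R \<le> 3 * real M + real l * (9/5 * t)" using R_real by linarith
    also have "real l * (9/5 * t) \<le> real l * ((real M - 1) / 10)"
      using Mt t11 by (intro mult_left_mono) auto
    also have "3 * real M \<le> 4 * (real M - 1)" using M220 by simp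
    finally have "real q * (real M - 1) \<le> (4 + real l / 10) * (real M - 1)"
      by (simp add: algebra_simps)
    thus ?thesis using M220 by (simp add: mult_le_cancel_right)
  qed
  define K where "K = (F \<times> (UNIV :: bool set)) <+> {..q}"
  define n where "n = (\<lambda>\<kappa>. case \<kappa> of
      Inl (p, \<beta>) \<Rightarrow> if \<beta> then c p else 3 * 2 ^ fst p - 1 - c p
    | Inr i \<Rightarrow> if i < q then M - 1 else s)"
  have finK: "finite K" using finF by (simp add: K_def)
  have sum_K: "(\<Sum>\<kappa>\<in>K. h (n \<kappa>)) = (\<Sum>p\<in>F. h (c p) + h (3 * 2 ^ fst p - 1 - c p)) + (real q * h (M - 1) + h s)"
    for h :: "nat \<Rightarrow> real"
  proof -
    have "(\<Sum>\<kappa>\<in>K. h (n \<kappa>)) = (\<Sum>z\<in>F \<times> UNIV. h (n (Inl z))) + (\<Sum>i\<le>q. h (n (Inr i)))"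
      unfolding K_def using finF by (subst sum.Plus) auto
    also have "(\<Sum>z\<in>F \<times> UNIV. h (n (Inl z))) = (\<Sum>p\<in>F. h (c p) + h (3 * 2 ^ fst p - 1 - c p))"
      unfolding sum.cartesian_product' by (intro sum.cong) (auto simp: UNIV_bool n_def)
    also have "(\<Sum>i\<le>q. h (n (Inr i))) = real q * h (M - 1) + h s"
      by (simp add: n_def lessThan_Suc_atMost[symmetric])
    finally show ?thesis .
  qed
  have card_K: "real (card K) = 2 * real (b * l) + real q + 1"
    using sum_K[of "\<lambda>_. 1"] finF by simp
  have c_sum: "c p + (3 * 2 ^ fst p - 1 - c p) = 3 * 2 ^ fst p - 1" if "p \<in> F" for p
    using c(1)[OF that] by simp
  have n_sum_real: "(\<Sum>\<kappa>\<in>K. real (n \<kappa>)) = real N"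
  proof -
    have "(\<Sum>p\<in>F. real (c p) + real (3 * 2 ^ fst p - 1 - c p)) = real T"
      unfolding T_def of_nat_sum
      by (intro sum.cong refl) (simp only: c_sum flip: of_nat_add)
    moreover have "real q * real (M - 1) + real s = real R" by (simp add: R_eq)
    ultimately show ?thesis
      using T_le by (simp add: sum_K R_def of_nat_diff)
  qed
  hence n_sum: "(\<Sum>\<kappa>\<in>K. n \<kappa>) = N"
    by (simp flip: of_nat_sum)
  have nM: "n \<kappa> < M" if "\<kappa> \<in> K" for \<kappa>
  proof -
    have "(2::nat) ^ Suc (fst p) \<le> M" if "p \<in> F" for p
      unfolding M_def using that by (intro power_increasing) (auto simp: F_def)
    moreover have "c p < 2 ^ Suc (fst p)" "3 * 2 ^ fst p - 1 - c p < 2 ^ Suc (fst p)" if "p \<in> F" for p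
      using c(1)[OF that] by auto
    ultimately have "c p < M" "3 * 2 ^ fst p - 1 - c p < M" if "p \<in> F" for p
      using that by (blast intro: order.strict_trans2)+
    moreover have "M - 1 < M" "s < M" using s_less by auto
    ultimately show ?thesis using that by (auto simp: K_def n_def)
  qed
  \<comment> \<open>Gain minus the two concentration losses minus 1 for each filler. Since 2 l / pi
    >= l / 2 and each loss is at most l / 10, as is the part of q that grows, at least l / 5 - 5
    remains.\<close>
  define A where "A = 2 * real l / pi - 2 * (real (b * l) * L) - 2 * (ln (real G) / L) - (real q + 1)"
  have A_ge: "2 \<le> A"
  proof -
    have "real l / 4 \<le> real l / pi" using pi_less_4 by (intro divide_left_mono) auto
    moreover have "real (b * l) * L = real l / 20" using b_nz by (simp add: L_def)
    moreover have "ln (real G) / L \<le> real l / 20"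
    proof -
      have "real G = 2 ^ 3 * real N" by (simp add: G_def)
      hence "ln (real G) = ln (2 ^ 3) + t"
        using N0 by (simp only: t_def) (subst ln_mult, auto)
      also have "ln (2 ^ 3 :: real) = real 3 * ln 2" by (rule ln_realpow)
      finally have lnG: "ln (real G) \<le> 6/5 * t"
        using ln2_le_25_over_36 t11 by simp
      have b30: "20 * real b \<le> 30 * t" using b_le by simp
      have "ln (real G) * (20 * real b) \<le> (6/5 * t) * (30 * t)"
        using lnG b30 by (rule mult_mono) (use t11 in auto)
      also have "(6/5 * t) * (30 * t) = 36 * t\<^sup>2" by (simp add: power2_eq_square)
      also have "36 * t\<^sup>2 \<le> real l / 20" using l_ge by simp
      finally show ?thesis by (simp add: L_def)
    qed
    ultimately show ?thesis using q_le l_big unfolding A_def by linarith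
  qed
  have r_le: "real (card K) \<le> 4 * (real l * t)"
  proof -
    have "real (b * l) \<le> 3/2 * (real l * t)"
      using mult_right_mono[OF b_le, of "real l"] by (simp add: mult_ac)
    moreover have "real l * 11 \<le> real l * t" using t11 by (intro mult_left_mono) auto
    ultimately show ?thesis using card_K q_le l_big by linarith
  qed
  have lt_N: "60 * (real l * t) \<le> real N"
  proof -
    have "3 * real l * (20 * t) \<le> 3 * real l * real M" using Mt by (intro mult_left_mono) auto
    thus ?thesis using lN' by (simp add: mult_ac)
  qed
  have sin_ge: "- (4 * real l) * sin (\<theta> / 2) \<le> (\<Sum>\<kappa>\<in>K. sin ((real (n \<kappa>) + 1/2) * \<theta>))" if "0 < \<theta>" "\<theta> \<le> pi" for \<theta>
  proof (rule sum_sin_ge_from_grid[where M = M and G = G and A = A and B = "4 * real l" and K = K and n = n and \<theta> = \<theta>])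
    show "0 < G" using N0 by (simp add: G_def)
    fix \<theta> assume "\<theta> \<in> {\<theta>. \<exists>k\<in>{1..G}. \<theta> = pi * real k / real G \<and> pi \<le> real M * \<theta>}"
    hence \<theta>: "\<theta> \<in> \<Theta>" by (simp add: \<Theta>_def)
    have "0 < card \<Theta>" using \<theta> fin\<Theta> by (auto simp: card_gt_0_iff)
    hence "ln (real (card \<Theta>)) / L \<le> ln (real G) / L"
      using card\<Theta> L by (intro divide_right_mono ln_mono) auto
    moreover have "- (real q + 1) \<le> real q * sin ((real (M - 1) + 1/2) * \<theta>) + sin ((real s + 1/2) * \<theta>)"
    proof -
      have "real q * (- 1) \<le> real q * sin ((real (M - 1) + 1/2) * \<theta>)" by (intro mult_left_mono) auto
      moreover have "- 1 \<le> sin ((real s + 1/2) * \<theta>)" by simp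
      ultimately show ?thesis by linarith
    qed
    moreover have "2 * (real l * (1 / pi - 2 * sin (\<theta> / 2)) - real (b * l) * L - ln (real (card \<Theta>)) / L)
      = 2 * real l / pi - 4 * real l * sin (\<theta> / 2) - 2 * (real (b * l) * L) - 2 * (ln (real (card \<Theta>)) / L)"
      by (simp add: algebra_simps)
    ultimately show "A - 4 * real l * sin (\<theta> / 2) \<le> (\<Sum>\<kappa>\<in>K. sin ((real (n \<kappa>) + 1/2) * \<theta>))"
      using c(2)[OF \<theta>] unfolding A_def sum_K[of "\<lambda>m. sin ((real m + 1/2) * \<theta>)"] by linarith
  next
    have "real l * 1 \<le> real l * t" using t11 by (intro mult_left_mono) auto
    hence "(\<Sum>\<kappa>\<in>K. real (n \<kappa>) + 1/2) + 4 * real l / 2 \<le> 2 * real N"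
      using n_sum_real r_le lt_N by (simp add: sum.distrib)
    hence "((\<Sum>\<kappa>\<in>K. real (n \<kappa>) + 1/2) + 4 * real l / 2) * (pi / real G) \<le> 2 * real N * (pi / real G)"
      by (intro mult_right_mono) auto
    also have "\<dots> = pi / 4" using N0 by (simp add: G_def)
    also have "\<dots> \<le> A" using A_ge pi_less_4 by linarith
    finally show "((\<Sum>\<kappa>\<in>K. real (n \<kappa>) + 1/2) + 4 * real l / 2) * (pi / real G) \<le> A" .
  qed (use nM that in auto)
  obtain a :: "nat \<Rightarrow> nat" where a: "\<And>j. j \<in> {1..N} \<Longrightarrow> 1 \<le> a j"
    "\<And>x. (\<Sum>j=1..N. cos (real (a j) * x)) = (\<Sum>\<kappa>\<in>K. \<Sum>k=1..n \<kappa>. cos (real k * x))"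
    using exists_enumeration_of_jumps[OF finK, where n = n and f = "\<lambda>k x. cos (real k * x)"]
    unfolding n_sum by blast
  show ?thesis
  proof
    show "1 \<le> a j" if "j \<in> {1..N}" for j by (rule a(1)[OF that])
    fix x
    have "real l * t \<le> 1460 * t\<^sup>2 * t" using l_le t11 by (intro mult_right_mono) auto
    hence lt: "real l * t \<le> 1460 * t ^ 3" by (simp add: t3(2) mult_ac)
    \<comment> \<open>The cost is at most 4 l t <= 5840 t^3, well inside the claimed bound.\<close>
    have "real l * 1 \<le> real l * t" using t11 by (intro mult_left_mono) auto
    hence "(4 * real l + real (card K)) / 2 \<le> 45000 * (1 + t ^ 3)"
      using lt r_le zero_le_power[OF \<open>0 \<le> t\<close>, of 3] by simp
    moreover have "- (4 * real l + real (card K)) / 2 \<le> (\<Sum>\<kappa>\<in>K. \<Sum>k=1..n \<kappa>. cos (real k * x))"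
      by (rule sum_cos_ge_from_sin[OF finK _ sin_ge]) auto
    ultimately show "- (45000 * (1 + t ^ 3)) \<le> (\<Sum>j=1..N. cos (real (a j) * x))"
      unfolding a(2) by linarith
  qed
qed

section \<open>The weight\<close>

lemma theta_block_min_le_theta_max:
  "\<forall>j\<in>{1..N}. 1 \<le> a j \<Longrightarrow> theta_block_min N a \<le> theta_max N"
  unfolding theta_max_def by (rule cSup_upper[OF _ theta_max_set(2)]) auto

lemma theta_wt_ge: "harm (2 * N) * (6 / pi\<^sup>2 - 1/2) / 60 \<le> theta_wt N"
proof -
  have "theta_max N \<le> real N / 24 - harm (2 * N) * (6 / pi\<^sup>2 - 1/2) / 720"
    unfolding theta_max_def
    by (rule cSup_least[OF theta_max_set(1)]) (auto intro: theta_block_min_upper_bound)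
  thus ?thesis unfolding theta_wt_def by (simp add: field_simps)
qed

text \<open>Follows from B >= 0 alone and settles every N below the threshold of the
  construction.\<close>

lemma theta_wt_le_half: "theta_wt N \<le> real N / 2"
proof -
  have "0 \<le> theta_block_min N (\<lambda>_. 1)"
  proof -
    obtain x where "theta_block_min N (\<lambda>_. 1) = (\<Sum>j=1..N. theta_B (real 1 * x))"
      using theta_block_min_attained[of N "\<lambda>_. 1"] by blast
    thus ?thesis by (simp only: sum_nonneg theta_B_nonneg)
  qed
  also have "\<dots> \<le> theta_max N" by (rule theta_block_min_le_theta_max) simp
  finally show ?thesis by (simp add: theta_wt_def)
qed

text \<open>Each dilate of the cosine sum is also at least -K and enters with a positive
  coefficient, so the block is at least N / 24 - K / (2 pi^2) * (pi^2 / 6) = N / 24 - K / 12. The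
  factor 12 in wt restores K.\<close>

lemma theta_wt_le_cosine_bound:
  assumes a: "\<And>j. j \<in> {1..N} \<Longrightarrow> 1 \<le> a j"
    and K: "\<And>x. - K \<le> (\<Sum>j=1..N. cos (real (a j) * x))"
  shows "theta_wt N \<le> K"
proof -
  obtain x where x: "theta_block_min N a = (\<Sum>j=1..N. theta_B (real (a j) * x))"
    using theta_block_min_attained by blast
  define C where "C = 1 / (2 * pi\<^sup>2)"
  have series: "(\<lambda>k. \<Sum>j=1..N. C * (cos (2 * pi * real (Suc k) * (real (a j) * x)) / (real (Suc k))\<^sup>2))
      sums (\<Sum>j=1..N. theta_B (real (a j) * x) - 1/24)"
    unfolding C_def by (intro sums_sum theta_B_sums)
  have minorant: "(\<lambda>k. - (K * C) * (1 / (real (Suc k))\<^sup>2)) sums (- (K * C) * (pi\<^sup>2 / 6))"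
    by (intro sums_mult inverse_squares_sums_Suc)
  have le: "- (K * C) * (1 / (real (Suc k))\<^sup>2)
      \<le> (\<Sum>j=1..N. C * (cos (2 * pi * real (Suc k) * (real (a j) * x)) / (real (Suc k))\<^sup>2))" for k
  proof -
    have "(C / (real (Suc k))\<^sup>2) * (- K) \<le> (C / (real (Suc k))\<^sup>2) * (\<Sum>j=1..N. cos (real (a j) * (2 * pi * real (Suc k) * x)))"
      by (intro mult_left_mono K) (simp add: C_def)
    also have "\<dots> = (\<Sum>j=1..N. C * (cos (2 * pi * real (Suc k) * (real (a j) * x)) / (real (Suc k))\<^sup>2))"
      by (simp add: sum_distrib_left mult_ac)
    finally show ?thesis by (simp add: mult_ac)
  qed
  have "- (K * C) * (pi\<^sup>2 / 6) \<le> (\<Sum>j=1..N. theta_B (real (a j) * x) - 1/24)"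
    by (rule sums_le[OF le minorant series])
  also have "\<dots> = theta_block_min N a - real N / 24" by (simp add: x sum_subtractf)
  finally have "- (K / 12) \<le> theta_block_min N a - real N / 24" by (simp add: C_def)
  moreover have "theta_block_min N a \<le> theta_max N"
    using a by (intro theta_block_min_le_theta_max) auto
  ultimately show ?thesis by (simp add: theta_wt_def)
qed

lemma theta_wt_le: "theta_wt N \<le> 45000 * (1 + (ln (real N)) ^ 3)"
proof (cases "90000 * (1 + (ln (real N)) ^ 3) < real N")
  case True
  obtain a where "\<And>j. j \<in> {1..N} \<Longrightarrow> 1 \<le> a j"
    "\<And>x. - (45000 * (1 + (ln (real N)) ^ 3)) \<le> (\<Sum>j=1..N. cos (real (a j) * x))"
    by (rule exists_cosine_multiset[OF True]) (rule that)
  thus ?thesis by (rule theta_wt_le_cosine_bound)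
next
  case False
  thus ?thesis using theta_wt_le_half[of N] by linarith
qed

theorem theorem4p3:
  fixes c :: real
  assumes c_def: "c = 60 / (6 / pi\<^sup>2 - 1/2)"
  shows "(555.930 \<le> c \<and> c < 555.931) \<and>
    (\<forall>N\<ge>1. harm (2 * N) / c \<le> theta_wt N \<and>
       theta_wt N \<le> 45000 * (1 + (ln (real N)) ^ 3)) \<and>
    theta_wt \<in> \<Omega>(\<lambda>N. ln (real N)) \<and>
    theta_wt \<in> O(\<lambda>N. (ln (real N)) ^ 3)"
proof (intro conjI allI impI)
  show c: "555.930 \<le> c" "c < 555.931"
    unfolding c_def by (rule littlewood_constant_bounds)+
  have lower: "harm (2 * N) / c \<le> theta_wt N" for N
    using theta_wt_ge[of N] by (simp add: c_def)
  show "harm (2 * N) / c \<le> theta_wt N" for N by (rule lower)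
  show "theta_wt N \<le> 45000 * (1 + (ln (real N)) ^ 3)" for N by (rule theta_wt_le)
  have c_pos: "0 < c" using c(1) by simp
  have ln_le: "ln (real N) / c \<le> theta_wt N" if "1 \<le> N" for N
  proof -
    have "ln (real N) \<le> ln (real (2 * N) + 1)" using that by (intro ln_mono) auto
    also have "\<dots> \<le> harm (2 * N)" by (rule ln_le_harm)
    finally have "ln (real N) / c \<le> harm (2 * N) / c" using c_pos by (intro divide_right_mono) auto
    thus ?thesis using lower[of N] by linarith
  qed
  have wt_nonneg: "0 \<le> theta_wt N" if "1 \<le> N" for N
  proof -
    have "0 \<le> ln (real N) / c" using that c_pos by simp
    thus ?thesis using ln_le[OF that] by linarith
  qed
  show "theta_wt \<in> \<Omega>(\<lambda>N. ln (real N))"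
  proof (rule landau_omega.bigI[of "1 / c"])
    show "\<forall>\<^sub>F N in sequentially. 1 / c * norm (ln (real N)) \<le> norm (theta_wt N)"
      using eventually_ge_at_top[of 1]
    proof eventually_elim
      case (elim N)
      thus ?case using ln_le[OF elim] wt_nonneg[OF elim] by simp
    qed
  qed (use c_pos in simp)
  show "theta_wt \<in> O(\<lambda>N. (ln (real N)) ^ 3)"
  \<comment> \<open>For N >= 3 the logarithm is at least 1, so the summand 1 is absorbed by doubling
    45000.\<close>
  proof (rule landau_o.bigI[of 90000])
    show "\<forall>\<^sub>F N in sequentially. norm (theta_wt N) \<le> 90000 * norm ((ln (real N)) ^ 3)"
      using eventually_ge_at_top[of 3]
    proof eventually_elim
      case (elim N)
      have "1 \<le> ln (real N)"
        using elim exp_le by (subst ln_ge_iff) auto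
      hence "1 \<le> (ln (real N)) ^ 3" by (rule one_le_power)
      thus ?case using theta_wt_le[of N] wt_nonneg[of N] elim by simp
    qed
  qed simp
qed

end
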